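(* Let $n\ge 2$ be an integer and let $(X_1,Y_1),\ldots,(X_n,Y_n)$ be $n$ independent copies of a random couple $(X,Y)$ of real random variables. Assume $X,Y$ are square integrable, $\mathrm{Var}(X)>0$, and that all the norms appearing in the definitions of $K$, $H_1(X,Y),\ldots,H_5(X,Y)$ (given in the context) are finite and all the denominators appearing there are non-zero (with the convention of the context for the terms of $K$ having $|\tau|$ in the denominator when $\tau=0$). Let $\hat\tau$ be the least squares slope estimator, $\hat\varepsilon_i$ the residuals, and $$\widehat v=\frac{n^{-1}\sum_{i=1}^n (X_i-\overline X)^2\,\hat\varepsilon_i^{\,2}}{\left(n^{-1}\sum_{i=1}^n (X_i-\overline X)^2\right)^2}.$$ Then $$\sup_{x\in\mathbb R}\left|\mathbb P\left(\frac{\sqrt n(\hat\tau-\tau)}{\sqrt{\widehat v}}\le x\right)-\Phi(x)\right|\le \frac{\log(n)}{\sqrt n}H_1(X,Y)+\frac{H_2(X,Y)}{\sqrt n}+\frac{H_3(X,Y)}{\sqrt{n\log(n)}}+\frac{H_4(X,Y)}{n}+\frac{H_5(X,Y)}{n^{3/2}}.$$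
   Context: Notation. $\Phi$ is the standard Gaussian cumulative distribution function; $\|Z\|_p=(\mathbb E|Z|^p)^{1/p}$. $\mu_X=\mathbb E(X)$, $\tilde X=X-\mu_X$, $\sigma_X^2=\mathrm{Var}(X)$, $\mu_Y=\mathbb E(Y)$, $\tilde Y=Y-\mu_Y$, $\sigma_Y^2=\mathrm{Var}(Y)$, $\tau=\mathrm{Cov}(X,Y)/\mathrm{Var}(X)$, $\varepsilon=\tilde Y-\tau\tilde X$, $\sigma_\varepsilon^2=\mathrm{Var}(\varepsilon)$. $\overline X=\frac1n\sum_{i=1}^n X_i$, $\overline Y=\frac1n\sum_{i=1}^n Y_i$, $$\hat\tau=\frac{\sum_{i=1}^n (X_i-\overline X)(Y_i-\overline Y)}{\sum_{i=1}^n(X_i-\overline X)^2},\quad \hat b=\overline Y-\hat\tau\,\overline X,\quad \hat\varepsilon_i=Y_i-\hat b-\hat\tau X_i .$$ On events where a denominator ($\sum_i(X_i-\overline X)^2$ or $\widehat v$) vanishes, the corresponding ratio is given an arbitrary fixed value (e.g. $0$). Constants. $c_{BE}>0$ is a universal constant such that the Berry-Esseen inequality $\sup_x|\mathbb P(\sqrt n\,\overline Z/\sigma_Z\le x)-\Phi(x)|\le c_{BE}\,\mathbb E|Z_1|^3/(\sigma_Z^3\sqrt n)$ holds for every $n\geq 1$ and all i.i.d. centered $Z_1,\dots,Z_n$ with finite third moment, $\overline Z=\frac1n\sum Z_i$ and $\sigma_Z^2=\mathrm{Var}(Z_1)>0$. $c_{1,R},c_{2,R}>0$ are universal constants such that Rosenthal's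 inequality $\left\|\frac1n\sum_{i=1}^nZ_i\right\|_q\le c_{1,R}\sqrt q\,\sqrt{\mathrm{Var}(Z_1)/n}+c_{2,R}\,q\,n^{-(q-1)/q}\|Z_1\|_q$ holds for every $q\ge2$, $n\ge 1$ and all i.i.d. centered $Z_1,\dots,Z_n$ with $\|Z_1\|_q<\infty$. Definition of $K$: $$K=\frac{\|\tilde X\varepsilon\|_2}{4}\min\Big(\tfrac{\|\tilde X\varepsilon\|_2}{36\|\tilde X^2\tilde Y\|_1\sigma_Y},\tfrac{\|\tilde X\varepsilon\|_2\sigma_X}{72\|\tilde X^2\tilde Y\|_1\sigma_Y},\tfrac{\|\tilde X\varepsilon\|_2\sigma_X}{72\|\tilde X\|_3^3\sigma_Y^2},\tfrac{\|\tilde X\varepsilon\|_2}{36|\tau|\|\tilde X\|_3^3\sigma_Y},\tfrac{\sigma_X^2}{288\|\tilde X^3\tilde Y\|_1},\tfrac{\sigma_X^3}{288\|\tilde X\|_4^4\sigma_Y},\tfrac{\sigma_X^2}{72|\tau|\|\tilde X\|_4^4},\tfrac{\|\tilde X\varepsilon\|_2}{\|\tilde X\varepsilon\|_4^2},\tfrac{\|\tilde X\varepsilon\|_2}{8\|\tilde Y^2\tilde X\|_1\sigma_X}\Big),$$ where, if $\tau=0$, the two terms with $|\tau|$ in the denominator are $+\infty$ (i.e. omitted from the minimum). Definition of $H_1,\ldots,H_5$: $$H_1(X,Y)=\frac{3\sigma_\varepsilon\sigma_X}{\sqrt{2\pi}\|\tilde X\varepsilon\|_2}+\frac1{\sqrt{2\pi}K},$$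 $$\begin{aligned}H_2(X,Y)&=19+\frac{1}{\|\tilde Y^2\tilde X\|_1}\left(2\|\tilde Y^2\tilde X\|_2+\sigma_X\|\tilde Y\|_4^2+4\sigma_Y\|\tilde X\tilde Y\|_2\right)\\&+\frac{9c_{BE}\|\tilde X\varepsilon\|_3^3}{\|\tilde X\varepsilon\|_2^3}+\frac{6c_{BE}\|\varepsilon\|_3^3}{\sigma_\varepsilon^3}+\frac{16c_{BE}\|\tilde X\|_3^3}{\sigma_X^3}+\frac{2c_{BE}\|\tilde X\varepsilon\|_6^6}{[\mathrm{Var}(\tilde X^2\varepsilon^2)]^{3/2}}+\frac{6c_{BE}\|\tilde Y\|_3^3}{\sigma_Y^3}\\&+4\frac{\|\tilde X^2\tilde Y\|_2}{\|\tilde X^2\tilde Y\|_1}+2\frac{\sigma_Y\|\tilde X\|_4^2}{\|\tilde X^2\tilde Y\|_1}+\frac{13}{2}\frac{\sigma_X\|\tilde X\|_4^2}{\|\tilde X\|_3^3}+9\frac{\|\tilde X\|_6^3}{\|\tilde X\|_3^3}+12\frac{\|\tilde Y\|_4^2}{\sigma_Y^2}+32\frac{\|\tilde X\|_4^2}{\sigma_X^2}\\&+2^{11/2}\frac{\|\tilde X^3\tilde Y\|_{3/2}^{3/2}}{\|\tilde X^3\tilde Y\|_1^{3/2}}+\frac34\frac{\sigma_Y\|\tilde X\|_6^3}{\|\tilde X^3\tilde Y\|_1}+16\frac{\|\tilde X\|_6^6}{\|\tilde X\|_4^6}+\frac{\sigma_X\|\tilde X\|_6^3}{\|\tilde X\|_4^4}+\frac{64\|\tilde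 Y^2\tilde X\|_1\sigma_X}{\|\tilde X\varepsilon\|_2^2}\\&+\frac{1120\|\tilde X\|_3^3\sigma_Y^2}{\|\tilde X\varepsilon\|_2^2\sigma_X}+64\sqrt2\frac{\|\tilde X\varepsilon\|_3^3}{\|\tilde X\varepsilon\|_2^3}+\frac{288\sigma_Y\|\tilde X^2\tilde Y\|_1}{\|\tilde X\varepsilon\|_2^2}+\frac{432|\tau|\|\tilde X\|_3^3\sigma_Y}{\|\tilde X\varepsilon\|_2^2}\\&+\frac{1152\|\tilde X^3\tilde Y\|_1}{\sigma_X^2\|\tilde X\varepsilon\|_2}+\frac{1152\|\tilde X\|_4^4\sigma_Y}{\sigma_X^3\|\tilde X\varepsilon\|_2}+\frac{576|\tau|\|\tilde X\|_4^4}{\sigma_X^2\|\tilde X\varepsilon\|_2}+\frac{576\|\tilde X^2\tilde Y\|_1\sigma_Y}{\|\tilde X\varepsilon\|_2^2\sigma_X},\end{aligned}$$ $$H_3(X,Y)=\frac{288K\sigma_\varepsilon}{\|\tilde X\varepsilon\|_2^2\sigma_X}\left[4\|\tilde X^3\tilde Y\|_1+4\frac{\sigma_Y\|\tilde X\|_4^4}{\sigma_X}+|\tau|\|\tilde X\|_4^4\right],$$ $$H_4(X,Y)=8\left[4+\frac{144\|\tilde X^3\tilde Y\|_1\sigma_\varepsilon}{\sigma_X\|\tilde X\varepsilon\|_2^2}+\frac{144\sigma_Y\sigma_\varepsilon\|\tilde X\|_4^4}{\|\tilde X\varepsilon\|_2^2\sigma_X^2}+\frac{72|\tau|\sigma_\varepsilon\|\tilde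 X\|_4^4}{\sigma_X\|\tilde X\varepsilon\|_2^2}+\frac{c_{1,R}^2\sigma_X^3}{\|\tilde X\|_3^3}+\frac{2c_{1,R}^2\sigma_X\sigma_Y^2}{\|\tilde Y^2\tilde X\|_1}\right],$$ $$H_5(X,Y)=32c_{2,R}^2\left[\frac{\sigma_X\|\tilde X\|_4^2}{\|\tilde X\|_3^3}+\frac{2\sigma_X\|\tilde Y\|_4^2}{\|\tilde Y^2\tilde X\|_1}\right].$$ *)

theory Defs
  imports "HOL-Probability.Probability"
begin

section \<open>Probabilistic preliminaries\<close>

definition std_normal_cdf :: "real \<Rightarrow> real" ("\<Phi>") where
  "\<Phi> = cdf std_normal_distribution"

definition Lp_norm :: "'a measure \<Rightarrow> real \<Rightarrow> ('a \<Rightarrow> real) \<Rightarrow> real" where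
  "Lp_norm M p Z = (\<integral>\<omega>. \<bar>Z \<omega>\<bar> powr p \<partial>M) powr (1 / p)"

text \<open>
  The Bochner integral of a non-integrable function is \<open>0\<close>, so \<open>Lp_norm\<close> is only meaningful
  together with the following predicate, which says that the norm is finite.
\<close>

definition finite_Lp_norm :: "'a measure \<Rightarrow> real \<Rightarrow> ('a \<Rightarrow> real) \<Rightarrow> bool" where
  "finite_Lp_norm M p Z \<longleftrightarrow>
     Z \<in> borel_measurable M \<and> integrable M (\<lambda>\<omega>. \<bar>Z \<omega>\<bar> powr p)"

definition centred :: "'a measure \<Rightarrow> ('a \<Rightarrow> real) \<Rightarrow> 'a \<Rightarrow> real" where
  "centred M Z \<omega> = Z \<omega> - integral\<^sup>L M Z"

definition covariance :: "'a measure \<Rightarrow> ('a \<Rightarrow> real) \<Rightarrow> ('a \<Rightarrow> real) \<Rightarrow> real" where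
  "covariance M X Y = (\<integral>\<omega>. centred M X \<omega> * centred M Y \<omega> \<partial>M)"

definition std_dev :: "'a measure \<Rightarrow> ('a \<Rightarrow> real) \<Rightarrow> real" where
  "std_dev M Z = sqrt (prob_space.variance M Z)"

text \<open>\<open>Z 1, \<dots>, Z n\<close> are independent copies of \<open>W\<close>.\<close>

definition independent_copies ::
  "'a measure \<Rightarrow> nat \<Rightarrow> (nat \<Rightarrow> 'a \<Rightarrow> 'b::topological_space) \<Rightarrow> ('a \<Rightarrow> 'b) \<Rightarrow> bool" where
  "independent_copies M n Z W \<longleftrightarrow>
     prob_space.indep_vars M (\<lambda>_. borel) Z {1..n} \<and>
     (\<forall>i\<in>{1..n}. distr M borel (Z i) = distr M borel W)"


section \<open>The universal constants\<close>

text \<open>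
  A definition cannot quantify over all types of sample spaces. Sample spaces on
  \<open>nat \<Rightarrow> real\<close> lose nothing: the joint law of any i.i.d. real random variables
  \<open>Z 1, \<dots>, Z n\<close> is realised by the coordinates on a product space of this type, and
  both inequalities only depend on that joint law.
\<close>

definition berry_esseen_constant :: "real \<Rightarrow> bool" where
  "berry_esseen_constant c \<longleftrightarrow> c > 0 \<and>
     (\<forall>(M :: (nat \<Rightarrow> real) measure) (Z :: nat \<Rightarrow> (nat \<Rightarrow> real) \<Rightarrow> real) (n::nat).
        prob_space M \<longrightarrow> n \<ge> 1 \<longrightarrow> independent_copies M n Z (Z 1) \<longrightarrow>
        finite_Lp_norm M 3 (Z 1) \<longrightarrow> integral\<^sup>L M (Z 1) = 0 \<longrightarrow>
        prob_space.variance M (Z 1) > 0 \<longrightarrow>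
        (SUP x::real. \<bar>measure M {\<omega> \<in> space M.
            sqrt (real n) * ((\<Sum>i=1..n. Z i \<omega>) / real n) / std_dev M (Z 1) \<le> x} - \<Phi> x\<bar>)
          \<le> c * (\<integral>\<omega>. \<bar>Z 1 \<omega>\<bar> ^ 3 \<partial>M) / (std_dev M (Z 1) ^ 3 * sqrt (real n)))"

definition rosenthal_constants :: "real \<Rightarrow> real \<Rightarrow> bool" where
  "rosenthal_constants c1 c2 \<longleftrightarrow> c1 > 0 \<and> c2 > 0 \<and>
     (\<forall>(M :: (nat \<Rightarrow> real) measure) (Z :: nat \<Rightarrow> (nat \<Rightarrow> real) \<Rightarrow> real) (n::nat) (q::real).
        prob_space M \<longrightarrow> n \<ge> 1 \<longrightarrow> q \<ge> 2 \<longrightarrow> independent_copies M n Z (Z 1) \<longrightarrow>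
        finite_Lp_norm M q (Z 1) \<longrightarrow> integral\<^sup>L M (Z 1) = 0 \<longrightarrow>
        Lp_norm M q (\<lambda>\<omega>. (\<Sum>i=1..n. Z i \<omega>) / real n)
          \<le> c1 * sqrt q * sqrt (prob_space.variance M (Z 1) / real n)
            + c2 * q * real n powr (- (q - 1) / q) * Lp_norm M q (Z 1))"


section \<open>Least squares estimators\<close>

text \<open>A ratio that takes the value \<open>d\<close> if the denominator vanishes.\<close>

definition ratio :: "real \<Rightarrow> real \<Rightarrow> real \<Rightarrow> real" where
  "ratio d a b = (if b = 0 then d else a / b)"

definition sample_mean :: "nat \<Rightarrow> (nat \<Rightarrow> real) \<Rightarrow> real" where
  "sample_mean n x = (\<Sum>i=1..n. x i) / real n"

definition slope_hat :: "real \<Rightarrow> nat \<Rightarrow> (nat \<Rightarrow> real) \<Rightarrow> (nat \<Rightarrow> real) \<Rightarrow> real" where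
  "slope_hat d n x y =
     ratio d (\<Sum>i=1..n. (x i - sample_mean n x) * (y i - sample_mean n y))
             (\<Sum>i=1..n. (x i - sample_mean n x)\<^sup>2)"

definition intercept_hat :: "real \<Rightarrow> nat \<Rightarrow> (nat \<Rightarrow> real) \<Rightarrow> (nat \<Rightarrow> real) \<Rightarrow> real" where
  "intercept_hat d n x y = sample_mean n y - slope_hat d n x y * sample_mean n x"

definition residual :: "real \<Rightarrow> nat \<Rightarrow> (nat \<Rightarrow> real) \<Rightarrow> (nat \<Rightarrow> real) \<Rightarrow> nat \<Rightarrow> real" where
  "residual d n x y i = y i - intercept_hat d n x y - slope_hat d n x y * x i"

text \<open>
  Here and below, \<open>d\<close>, \<open>d'\<close> and \<open>d''\<close> are the values of, respectively, the slope estimator,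
  the variance estimator and the studentised statistic where their denominators vanish.
\<close>

definition v_hat :: "real \<Rightarrow> real \<Rightarrow> nat \<Rightarrow> (nat \<Rightarrow> real) \<Rightarrow> (nat \<Rightarrow> real) \<Rightarrow> real" where
  "v_hat d d' n x y =
     ratio d' ((\<Sum>i=1..n. (x i - sample_mean n x)\<^sup>2 * (residual d n x y i)\<^sup>2) / real n)
              (((\<Sum>i=1..n. (x i - sample_mean n x)\<^sup>2) / real n)\<^sup>2)"

definition studentised_slope ::
  "real \<Rightarrow> real \<Rightarrow> real \<Rightarrow> real \<Rightarrow> nat \<Rightarrow> (nat \<Rightarrow> real) \<Rightarrow> (nat \<Rightarrow> real) \<Rightarrow> real" where
  "studentised_slope d d' d'' t n x y =
     ratio d'' (sqrt (real n) * (slope_hat d n x y - t)) (sqrt (v_hat d d' n x y))"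


section \<open>The constants of the bound\<close>

definition slope :: "'a measure \<Rightarrow> ('a \<Rightarrow> real) \<Rightarrow> ('a \<Rightarrow> real) \<Rightarrow> real" where
  "slope M X Y = covariance M X Y / prob_space.variance M X"

definition regression_error ::
  "'a measure \<Rightarrow> ('a \<Rightarrow> real) \<Rightarrow> ('a \<Rightarrow> real) \<Rightarrow> 'a \<Rightarrow> real" where
  "regression_error M X Y \<omega> = centred M Y \<omega> - slope M X Y * centred M X \<omega>"

context
  fixes M :: "'a measure" and X Y :: "'a \<Rightarrow> real"
begin

text \<open>
  In the names below, \<open>X\<close>, \<open>Y\<close> and \<open>E\<close> stand for the centred \<open>X\<close>, the centred \<open>Y\<close> and
  the error \<open>\<epsilon>\<close>, and digits are exponents: \<open>nX2Y p\<close> is the \<open>L\<^sup>p\<close> norm of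
  (centred \<open>X\<close>)\<open>\<^sup>2\<close> times (centred \<open>Y\<close>).
\<close>

abbreviation (input) "Xt \<equiv> centred M X"
abbreviation (input) "Yt \<equiv> centred M Y"
abbreviation (input) "Er \<equiv> regression_error M X Y"

abbreviation (input) "tau \<equiv> slope M X Y"
abbreviation (input) "sX \<equiv> std_dev M X"
abbreviation (input) "sY \<equiv> std_dev M Y"
abbreviation (input) "sE \<equiv> std_dev M Er"
abbreviation (input) "varX2E2 \<equiv> prob_space.variance M (\<lambda>\<omega>. (Xt \<omega>)\<^sup>2 * (Er \<omega>)\<^sup>2)"

abbreviation (input) "nX p \<equiv> Lp_norm M p Xt"
abbreviation (input) "nY p \<equiv> Lp_norm M p Yt"
abbreviation (input) "nE p \<equiv> Lp_norm M p Er"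
abbreviation (input) "nXE p \<equiv> Lp_norm M p (\<lambda>\<omega>. Xt \<omega> * Er \<omega>)"
abbreviation (input) "nXY p \<equiv> Lp_norm M p (\<lambda>\<omega>. Xt \<omega> * Yt \<omega>)"
abbreviation (input) "nX2Y p \<equiv> Lp_norm M p (\<lambda>\<omega>. (Xt \<omega>)\<^sup>2 * Yt \<omega>)"
abbreviation (input) "nX3Y p \<equiv> Lp_norm M p (\<lambda>\<omega>. (Xt \<omega>) ^ 3 * Yt \<omega>)"
abbreviation (input) "nY2X p \<equiv> Lp_norm M p (\<lambda>\<omega>. (Yt \<omega>)\<^sup>2 * Xt \<omega>)"

definition K_const :: real where
  "K_const = nXE 2 / 4 * Min (
     { nXE 2 / (36 * nX2Y 1 * sY),
       nXE 2 * sX / (72 * nX2Y 1 * sY),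
       nXE 2 * sX / (72 * nX 3 ^ 3 * sY\<^sup>2),
       sX\<^sup>2 / (288 * nX3Y 1),
       sX ^ 3 / (288 * nX 4 ^ 4 * sY),
       nXE 2 / (nXE 4)\<^sup>2,
       nXE 2 / (8 * nY2X 1 * sX) } \<union>
     (if tau = 0 then {}
      else { nXE 2 / (36 * \<bar>tau\<bar> * nX 3 ^ 3 * sY),
             sX\<^sup>2 / (72 * \<bar>tau\<bar> * nX 4 ^ 4) }))"

definition H1 :: real where
  "H1 = 3 * sE * sX / (sqrt (2 * pi) * nXE 2) + 1 / (sqrt (2 * pi) * K_const)"

definition H2 :: "real \<Rightarrow> real" where
  "H2 c\<^sub>B\<^sub>E = 19
     + 1 / nY2X 1 * (2 * nY2X 2 + sX * (nY 4)\<^sup>2 + 4 * sY * nXY 2)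
     + 9 * c\<^sub>B\<^sub>E * nXE 3 ^ 3 / nXE 2 ^ 3
     + 6 * c\<^sub>B\<^sub>E * nE 3 ^ 3 / sE ^ 3
     + 16 * c\<^sub>B\<^sub>E * nX 3 ^ 3 / sX ^ 3
     + 2 * c\<^sub>B\<^sub>E * nXE 6 ^ 6 / varX2E2 powr (3/2)
     + 6 * c\<^sub>B\<^sub>E * nY 3 ^ 3 / sY ^ 3
     + 4 * (nX2Y 2 / nX2Y 1)
     + 2 * (sY * (nX 4)\<^sup>2 / nX2Y 1)
     + 13/2 * (sX * (nX 4)\<^sup>2 / nX 3 ^ 3)
     + 9 * (nX 6 ^ 3 / nX 3 ^ 3)
     + 12 * ((nY 4)\<^sup>2 / sY\<^sup>2)
     + 32 * ((nX 4)\<^sup>2 / sX\<^sup>2)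
     + 2 powr (11/2) * (nX3Y (3/2) powr (3/2) / nX3Y 1 powr (3/2))
     + 3/4 * (sY * nX 6 ^ 3 / nX3Y 1)
     + 16 * (nX 6 ^ 6 / nX 4 ^ 6)
     + sX * nX 6 ^ 3 / nX 4 ^ 4
     + 64 * nY2X 1 * sX / (nXE 2)\<^sup>2
     + 1120 * nX 3 ^ 3 * sY\<^sup>2 / ((nXE 2)\<^sup>2 * sX)
     + 64 * sqrt 2 * (nXE 3 ^ 3 / nXE 2 ^ 3)
     + 288 * sY * nX2Y 1 / (nXE 2)\<^sup>2
     + 432 * \<bar>tau\<bar> * nX 3 ^ 3 * sY / (nXE 2)\<^sup>2
     + 1152 * nX3Y 1 / (sX\<^sup>2 * nXE 2)
     + 1152 * nX 4 ^ 4 * sY / (sX ^ 3 * nXE 2)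
     + 576 * \<bar>tau\<bar> * nX 4 ^ 4 / (sX\<^sup>2 * nXE 2)
     + 576 * nX2Y 1 * sY / ((nXE 2)\<^sup>2 * sX)"

definition H3 :: real where
  "H3 = 288 * K_const * sE / ((nXE 2)\<^sup>2 * sX)
     * (4 * nX3Y 1 + 4 * (sY * nX 4 ^ 4 / sX) + \<bar>tau\<bar> * nX 4 ^ 4)"

definition H4 :: "real \<Rightarrow> real" where
  "H4 c\<^sub>1\<^sub>R = 8 * (4
     + 144 * nX3Y 1 * sE / (sX * (nXE 2)\<^sup>2)
     + 144 * sY * sE * nX 4 ^ 4 / ((nXE 2)\<^sup>2 * sX\<^sup>2)
     + 72 * \<bar>tau\<bar> * sE * nX 4 ^ 4 / (sX * (nXE 2)\<^sup>2)
     + c\<^sub>1\<^sub>R\<^sup>2 * sX ^ 3 / nX 3 ^ 3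
     + 2 * c\<^sub>1\<^sub>R\<^sup>2 * sX * sY\<^sup>2 / nY2X 1)"

definition H5 :: "real \<Rightarrow> real" where
  "H5 c\<^sub>2\<^sub>R = 32 * c\<^sub>2\<^sub>R\<^sup>2 *
     (sX * (nX 4)\<^sup>2 / nX 3 ^ 3 + 2 * sX * (nY 4)\<^sup>2 / nY2X 1)"

text \<open>
  \<open>all_norms_finite\<close> and \<open>all_denominators_nonzero\<close> range over the norms and the
  denominators that occur in the six definitions above.
\<close>

definition all_norms_finite :: bool where
  "all_norms_finite \<longleftrightarrow>
     (\<forall>p\<in>{3, 4, 6}. finite_Lp_norm M p Xt) \<and>
     (\<forall>p\<in>{3, 4}. finite_Lp_norm M p Yt) \<and>
     finite_Lp_norm M 3 Er \<and>
     (\<forall>p\<in>{2, 3, 4, 6}. finite_Lp_norm M p (\<lambda>\<omega>. Xt \<omega> * Er \<omega>)) \<and>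
     finite_Lp_norm M 2 (\<lambda>\<omega>. Xt \<omega> * Yt \<omega>) \<and>
     (\<forall>p\<in>{1, 2}. finite_Lp_norm M p (\<lambda>\<omega>. (Xt \<omega>)\<^sup>2 * Yt \<omega>)) \<and>
     (\<forall>p\<in>{1, 3/2}. finite_Lp_norm M p (\<lambda>\<omega>. (Xt \<omega>) ^ 3 * Yt \<omega>)) \<and>
     (\<forall>p\<in>{1, 2}. finite_Lp_norm M p (\<lambda>\<omega>. (Yt \<omega>)\<^sup>2 * Xt \<omega>))"

definition all_denominators_nonzero :: bool where
  "all_denominators_nonzero \<longleftrightarrow>
     sX \<noteq> 0 \<and> sY \<noteq> 0 \<and> sE \<noteq> 0 \<and> varX2E2 \<noteq> 0 \<and>
     nX 3 \<noteq> 0 \<and> nX 4 \<noteq> 0 \<and> nXE 2 \<noteq> 0 \<and> nXE 4 \<noteq> 0 \<and>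
     nX2Y 1 \<noteq> 0 \<and> nX3Y 1 \<noteq> 0 \<and> nY2X 1 \<noteq> 0 \<and> K_const \<noteq> 0"

end

end

theory Submission
  imports Defs
begin

text \<open>
  With errors \<open>e\<close>, the statistic is \<open>sqrt n * (mean (x e) - mean x * mean e) / V\<close>, where \<open>V\<close> is the
  empirical \<open>L\<^sup>2\<close> norm of the products of centred regressors and residuals. Put \<open>u = sqrt (ln n / n)\<close>
  and let \<open>s\<close> be the \<open>L\<^sup>2\<close> norm of \<open>X \<epsilon>\<close>. The Berry--Esseen bound and the Gaussian tail, which is
  of order \<open>1 / sqrt n\<close> at \<open>sqrt (ln n)\<close>, keep \<open>mean x\<close>, \<open>mean e\<close>, \<open>mean (x e)\<close> and \<open>mean (x\<^sup>2 e\<^sup>2) - s\<^sup>2\<close>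
  within \<open>u\<close> standard deviations, and Chebyshev's inequality controls the empirical moments of orders
  two and four, all up to an event of probability \<open>O(1 / sqrt n)\<close>. Outside this event, Minkowski's
  inequality compares \<open>V\<close> with the empirical norm of \<open>x e\<close> and yields \<open>\<bar>V / s - 1\<bar> \<le> u / (2 K)\<close>, because
  two interpolation inequalities between moments bound the relevant ratios by multiples of \<open>1 / K\<close>.
  Hence the statistic is a shifted and rescaled normalised sum of the \<open>x e\<close>, to which Berry--Esseen
  applies; the bound is trivial unless \<open>n\<close> is large and \<open>u / K\<close> is bounded.
\<close>

section \<open>The standard normal distribution\<close>

text \<open>At \<open>u\<close> standard deviations of a sample mean, Chebyshev's inequality would
  give only \<open>1 / ln n\<close>. The four means that have to be small to order \<open>u\<close>
  are therefore controlled by Berry--Esseen, and \<open>sqrt (ln n)\<close> is the level at which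
  the Gaussian tail bound \<open>exp (- ln n / 2)\<close> drops to the Berry--Esseen rate
  \<open>1 / sqrt n\<close>. The empirical second and fourth moments have to be right only up to a
  constant factor, so variance bounds at a fixed relative level serve for them. The two summands of
  \<open>H1\<close> are the two perturbations of the normalised sum. The shift
  \<open>sqrt n * mean x * mean e / s\<close> is at most \<open>sqrt n * u^2 * sX * sE / s\<close>,
  and \<open>sqrt n * u^2 = ln n / sqrt n\<close>. The scale \<open>V / s\<close> is off by at most
  \<open>u / (2 * K)\<close>. A wrong scale moves the argument \<open>x\<close> by an amount
  proportional to \<open>\<bar>x\<bar>\<close>; uniformity in \<open>x\<close> comes from the decay
  of the Gaussian density. The Berry--Esseen error of the sum itself and the exceptional
  probabilities are charged to \<open>H2\<close>.\<close>

lemma std_normal_density_le: "std_normal_density t \<le> 1 / sqrt (2 * pi)"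
  by (simp add: std_normal_density_def divide_right_mono)

text \<open>The exact maximum is \<open>exp (- 1 / 2)\<close>, attained at \<open>t = 1\<close>; the
  slightly larger \<open>1 / sqrt 2\<close> follows from \<open>1 + z <= exp z\<close>
  alone.\<close>

lemma mult_exp_half_square_le: "t * exp (- t\<^sup>2 / 2) \<le> 1 / sqrt 2" for t :: real
proof -
  have "0 \<le> (t - sqrt 2)\<^sup>2" by simp
  then have "sqrt 2 * t \<le> 1 + t\<^sup>2 / 2"
    by (simp add: power2_eq_square algebra_simps)
  also have "\<dots> \<le> exp (t\<^sup>2 / 2)" by (rule exp_ge_add_one_self)
  finally have "sqrt 2 * t * exp (- t\<^sup>2 / 2) \<le> 1"
    by (simp add: exp_minus field_simps)
  then show ?thesis by (simp add: field_simps)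
qed

text \<open>The density bound is asked for on the interval only, so that
  \<open>std_normal_cdf_perturb\<close> can insert one that improves with the distance from
  0.\<close>

lemma std_normal_cdf_diff_le:
  assumes "a \<le> b" and C: "\<And>t. a < t \<Longrightarrow> t \<le> b \<Longrightarrow> std_normal_density t \<le> C"
  shows "\<Phi> b - \<Phi> a \<le> C * (b - a)"
proof (cases "a = b")
  case False
  with assms have "a < b" by simp
  interpret N: real_distribution std_normal_distribution by (rule real_dist_normal_dist)
  have C0: "0 \<le> C" using C[of b] \<open>a < b\<close> normal_density_nonneg[of 0 1 b] by linarith
  have "emeasure std_normal_distribution {a<..b}
      = (\<integral>\<^sup>+t. ennreal (std_normal_density t) * indicator {a<..b} t \<partial>lborel)"
    by (rule emeasure_density) auto
  also have "\<dots> \<le> (\<integral>\<^sup>+t. ennreal C * indicator {a<..b} t \<partial>lborel)"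
    by (intro nn_integral_mono) (auto simp: indicator_def intro!: ennreal_leI C)
  also have "\<dots> = ennreal (C * (b - a))"
    using \<open>a < b\<close> C0 by (simp add: nn_integral_cmult_indicator ennreal_mult)
  finally have "measure std_normal_distribution {a<..b} \<le> C * (b - a)"
    using C0 \<open>a < b\<close> by (simp add: N.emeasure_eq_measure)
  then show ?thesis
    using N.cdf_diff_eq[OF \<open>a < b\<close>] by (simp add: std_normal_cdf_def)
qed simp

lemma std_normal_cdf_nonneg: "0 \<le> \<Phi> x"
  and std_normal_cdf_le_1: "\<Phi> x \<le> 1"
  using real_dist_normal_dist
  by (auto simp: std_normal_cdf_def cdf_def prob_space.prob_le_1
      dest: real_distribution.axioms(1))

lemma std_normal_density_shift_le:
  assumes "0 \<le> a * t"
  shows "std_normal_density (a + t) \<le> exp (- a\<^sup>2 / 2) * std_normal_density t"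
proof -
  have "exp (- (a + t)\<^sup>2 / 2) \<le> exp (- a\<^sup>2 / 2 + - t\<^sup>2 / 2)"
    using assms by (simp add: power2_sum field_simps)
  also have "\<dots> = exp (- a\<^sup>2 / 2) * exp (- t\<^sup>2 / 2)" by (rule exp_add)
  finally have "exp (- (a + t)\<^sup>2 / 2) \<le> exp (- a\<^sup>2 / 2) * exp (- t\<^sup>2 / 2)" .
  then show ?thesis
    by (simp add: std_normal_density_def divide_right_mono)
qed

text \<open>After translation by \<open>a\<close>, the sign condition removes the cross term of
  \<open>(a + t)^2\<close>, which leaves the stated factor times the total mass 1. Since
  \<open>a\<close> may have either sign, both tails are covered.\<close>

lemma std_normal_tail:
  assumes S: "S \<in> sets borel" and T: "\<And>t. a + t \<in> S \<Longrightarrow> 0 \<le> a * t"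
  shows "measure std_normal_distribution S \<le> exp (- a\<^sup>2 / 2)"
proof -
  interpret N: real_distribution std_normal_distribution by (rule real_dist_normal_dist)
  have [measurable]: "S \<in> sets borel" by fact
  have "emeasure std_normal_distribution S
      = (\<integral>\<^sup>+t. ennreal (std_normal_density t) * indicator S t \<partial>lborel)"
    by (rule emeasure_density) (use S in auto)
  also have "\<dots> = (\<integral>\<^sup>+t. ennreal (std_normal_density (a + t)) * indicator S (a + t) \<partial>lborel)"
    by (subst nn_integral_real_affine[where t = a and c = 1]) simp_all
  also have "\<dots> \<le> (\<integral>\<^sup>+t. ennreal (exp (- a\<^sup>2 / 2)) * ennreal (std_normal_density t) \<partial>lborel)"
    using T by (intro nn_integral_mono)
      (auto simp: indicator_def ennreal_mult[symmetric] intro!: ennreal_leI std_normal_density_shift_le[simplified])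
  also have "\<dots> = ennreal (exp (- a\<^sup>2 / 2))"
    by (simp add: nn_integral_cmult nn_integral_eq_integral)
  finally show ?thesis by (simp add: N.emeasure_eq_measure)
qed

lemma std_normal_cdf_lower_tail:
  assumes "0 \<le> u" shows "\<Phi> (- u) \<le> exp (- u\<^sup>2 / 2)"
  unfolding std_normal_cdf_def cdf_def
  using std_normal_tail[of "{..- u}" "- u"] assms by (auto simp: mult_nonneg_nonpos)

lemma std_normal_cdf_upper_tail:
  assumes "0 \<le> u" shows "1 - \<Phi> u \<le> exp (- u\<^sup>2 / 2)"
proof -
  interpret N: real_distribution std_normal_distribution by (rule real_dist_normal_dist)
  have "1 - \<Phi> u = measure std_normal_distribution (space std_normal_distribution - {..u})"
    unfolding std_normal_cdf_def cdf_def by (subst N.prob_compl) auto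
  also have "\<dots> \<le> exp (- u\<^sup>2 / 2)"
    using assms by (intro std_normal_tail) auto
  finally show ?thesis .
qed

text \<open>The density is at most \<open>1 / (\<bar>t\<bar> sqrt (4 pi))\<close>, which absorbs the factor \<open>\<bar>x\<bar>\<close> of a
  relative perturbation of the argument.\<close>

lemma std_normal_cdf_perturb:
  assumes "0 \<le> \<delta>" "\<delta> < 1" "0 \<le> \<eta>" "\<bar>b - a\<bar> \<le> \<delta> * \<bar>x\<bar> + \<eta>" "a \<le> b" "a = x \<or> b = x"
  shows "\<Phi> b - \<Phi> a \<le> (\<eta> + \<delta> / ((1 - \<delta>) * sqrt 2)) / sqrt (2 * pi)"
proof -
  \<comment> \<open>\<open>m\<close> splits the interval from \<open>a\<close> to \<open>b\<close>:
    between \<open>x\<close> and \<open>m\<close> lies the relative part, of length at most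
    \<open>\<delta> * \<bar>x\<bar>\<close>, and the rest has length at most
    \<open>\<eta>\<close>.\<close>
  define m where "m = (if a = x then min b (x + \<delta> * \<bar>x\<bar>) else max a (x - \<delta> * \<bar>x\<bar>))"
  let ?K = "1 / ((1 - \<delta>) * sqrt 2) / sqrt (2 * pi)"
  have pi: "0 < sqrt (2 * pi)" by simp
  have rel: "\<Phi> d - \<Phi> c \<le> \<delta> * ?K" if "c \<le> d" "x - \<delta> * \<bar>x\<bar> \<le> c" "d \<le> x + \<delta> * \<bar>x\<bar>" "c = x \<or> d = x" for c d
  proof (cases "x = 0")
    case True
    with that have "c = d" by auto
    then show ?thesis using assms by simp
  next
    case False
    define r where "r = (1 - \<delta>) * \<bar>x\<bar>"
    have r: "0 < r" using assms False by (simp add: r_def)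
    have "\<Phi> d - \<Phi> c \<le> (1 / (r * sqrt 2) / sqrt (2 * pi)) * (d - c)"
    proof (rule std_normal_cdf_diff_le)
      fix t assume t: "c < t" "t \<le> d"
      \<comment> \<open>All points of the relative part are within
        \<open>\<delta> * \<bar>x\<bar>\<close> of \<open>x\<close>, so they keep the distance
        \<open>r\<close> from 0; this is where \<open>\<delta> < 1\<close> enters.\<close>
      have rt: "r \<le> \<bar>t\<bar>"
        using t that assms(1,2) unfolding r_def
        by (smt (verit, ccfv_threshold) mult_left_le_one_le mult_minus_left left_diff_distrib mult_cancel_right1)
      have "r * exp (- t\<^sup>2 / 2) \<le> \<bar>t\<bar> * exp (- \<bar>t\<bar>\<^sup>2 / 2)"
        using rt by (simp add: mult_right_mono)
      also have "\<dots> \<le> 1 / sqrt 2" by (rule mult_exp_half_square_le)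
      finally have "exp (- t\<^sup>2 / 2) \<le> 1 / (r * sqrt 2)"
        using r by (simp add: field_simps)
      then show "std_normal_density t \<le> 1 / (r * sqrt 2) / sqrt (2 * pi)"
        unfolding std_normal_density_def using divide_right_mono[OF _ less_imp_le[OF pi]] by fastforce
    qed fact
    also have "\<dots> \<le> (1 / (r * sqrt 2) / sqrt (2 * pi)) * (\<delta> * \<bar>x\<bar>)"
      using that r by (intro mult_left_mono) auto
    also have "\<dots> = \<delta> * ?K" using False by (simp add: r_def)
    finally show ?thesis .
  qed
  have ab: "\<Phi> d - \<Phi> c \<le> \<eta> / sqrt (2 * pi)" if "c \<le> d" "d - c \<le> \<eta>" for c d
  proof -
    have "\<Phi> d - \<Phi> c \<le> 1 / sqrt (2 * pi) * (d - c)"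
      by (rule std_normal_cdf_diff_le[OF that(1) std_normal_density_le])
    also have "\<dots> \<le> 1 / sqrt (2 * pi) * \<eta>" using that by (intro mult_left_mono) auto
    finally show ?thesis by simp
  qed
  have nn: "0 \<le> \<delta> * \<bar>x\<bar>" using assms by simp
  have "\<Phi> b - \<Phi> a \<le> \<eta> / sqrt (2 * pi) + \<delta> * ?K"
  proof (cases "a = x")
    case True
    have "\<Phi> m - \<Phi> a \<le> \<delta> * ?K" using True assms nn by (intro rel) (auto simp: m_def)
    moreover have "\<Phi> b - \<Phi> m \<le> \<eta> / sqrt (2 * pi)" using True assms nn by (intro ab) (auto simp: m_def)
    ultimately show ?thesis by linarith
  next
    case False
    then have "b = x" using assms by simp
    have "\<Phi> b - \<Phi> m \<le> \<delta> * ?K" using False \<open>b = x\<close> assms nn by (intro rel) (auto simp: m_def)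
    moreover have "\<Phi> m - \<Phi> a \<le> \<eta> / sqrt (2 * pi)" using False \<open>b = x\<close> assms nn by (intro ab) (auto simp: m_def)
    ultimately show ?thesis by linarith
  qed
  then show ?thesis by (simp add: add_divide_distrib)
qed

section \<open>Sample means of independent copies\<close>

lemma independent_copies_compose:
  assumes M: "prob_space M" and Z: "independent_copies M n Z W"
    and W: "W \<in> borel_measurable M" and g: "g \<in> borel_measurable borel"
  shows "independent_copies M n (\<lambda>i \<omega>. g (Z i \<omega>)) (\<lambda>\<omega>. g (W \<omega>))"
proof -
  interpret prob_space M by fact
  have indep: "indep_vars (\<lambda>_. borel) Z {1..n}"
    using Z by (simp add: independent_copies_def)
  have Zm: "Z i \<in> borel_measurable M" if "i \<in> {1..n}" for i
    using indep that by (auto simp: indep_vars_def)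
  have "distr M borel (\<lambda>\<omega>. g (Z i \<omega>)) = distr M borel (\<lambda>\<omega>. g (W \<omega>))" if "i \<in> {1..n}" for i
  proof -
    have "distr (distr M borel (Z i)) borel g = distr (distr M borel W) borel g"
      using Z that by (simp add: independent_copies_def)
    then show ?thesis
      using Zm[OF that] W g by (simp add: distr_distr comp_def)
  qed
  then show ?thesis
    using indep_vars_compose2[OF indep, of "\<lambda>_. g" "\<lambda>_. borel"] g
    by (simp add: independent_copies_def)
qed

lemma independent_copies_measurable:
  assumes "prob_space M" "independent_copies M n Z W" "i \<in> {1..n}"
  shows "Z i \<in> borel_measurable M"
  using assms prob_space.indep_vars_def by (auto simp: independent_copies_def prob_space.indep_vars_def)

lemma independent_copies_integral:
  fixes f :: "'b::topological_space \<Rightarrow> real"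
  assumes "prob_space M" "independent_copies M n Z W" "W \<in> borel_measurable M" "i \<in> {1..n}"
    and f: "f \<in> borel_measurable borel"
  shows "(\<integral>\<omega>. f (Z i \<omega>) \<partial>M) = (\<integral>\<omega>. f (W \<omega>) \<partial>M)"
    and "integrable M (\<lambda>\<omega>. f (Z i \<omega>)) \<longleftrightarrow> integrable M (\<lambda>\<omega>. f (W \<omega>))"
proof -
  have "distr M borel (Z i) = distr M borel W"
    using assms by (simp add: independent_copies_def)
  moreover have "Z i \<in> borel_measurable M"
    using assms independent_copies_measurable by blast
  ultimately show "(\<integral>\<omega>. f (Z i \<omega>) \<partial>M) = (\<integral>\<omega>. f (W \<omega>) \<partial>M)"
    and "integrable M (\<lambda>\<omega>. f (Z i \<omega>)) \<longleftrightarrow> integrable M (\<lambda>\<omega>. f (W \<omega>))"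
    using assms by (metis integral_distr, metis integrable_distr_eq)
qed

text \<open>The constants are defined on sample spaces of sequences, so the inequality is applied to the
  joint law of the variables.\<close>

lemma berry_esseen_iid:
  fixes Z :: "nat \<Rightarrow> 'a \<Rightarrow> real"
  assumes M: "prob_space M" and c: "berry_esseen_constant c" and n: "n \<ge> 1"
    and Z: "independent_copies M n Z W" and W: "W \<in> borel_measurable M"
    and W3: "integrable M (\<lambda>\<omega>. \<bar>W \<omega>\<bar> ^ 3)" and W0: "integral\<^sup>L M W = 0"
    and Wv: "prob_space.variance M W > 0"
  shows "\<bar>measure M {\<omega> \<in> space M. sqrt (real n) * sample_mean n (\<lambda>i. Z i \<omega>) / std_dev M W \<le> x} - \<Phi> x\<bar>
    \<le> c * (\<integral>\<omega>. \<bar>W \<omega>\<bar> ^ 3 \<partial>M) / (std_dev M W ^ 3 * sqrt (real n))"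
proof -
  interpret prob_space M by fact
  define I where "I = {1..n}"
  have I: "I \<noteq> {}" "1 \<in> I" using n by (auto simp: I_def)
  have Zm: "Z i \<in> borel_measurable M" if "i \<in> I" for i
    using independent_copies_measurable[OF M Z] that by (simp add: I_def)
  have indep: "indep_vars (\<lambda>_. borel) Z I"
    using Z by (simp add: independent_copies_def I_def)
  define J where "J \<omega> = (\<lambda>i\<in>I. Z i \<omega>)" for \<omega>
  have J[measurable]: "J \<in> M \<rightarrow>\<^sub>M (\<Pi>\<^sub>M i\<in>I. borel)"
    unfolding J_def by (intro measurable_restrict Zm)
  \<comment> \<open>\<open>N\<close> is the joint law; its coordinates play the role of the
    \<open>Z i\<close>, and extensional functions on \<open>I\<close> are still of type
    \<open>nat \<Rightarrow> real\<close>.\<close>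
  define N where "N = distr M (\<Pi>\<^sub>M i\<in>I. (borel :: real measure)) J"
  have N: "prob_space N" unfolding N_def by (rule prob_space_distr[OF J])
  interpret N: prob_space N by fact
  have sN: "sets N = sets (\<Pi>\<^sub>M i\<in>I. (borel :: real measure))" by (simp add: N_def)
  have comp: "(\<lambda>f. f i) \<in> borel_measurable N" if "i \<in> I" for i
    using that unfolding measurable_cong_sets[OF sN refl] by (rule measurable_component_singleton)
  have comp_distr: "distr N borel (\<lambda>f. f i) = distr M borel (Z i)" if "i \<in> I" for i
    unfolding N_def using that by (subst distr_distr) (auto simp: comp_def J_def)
  \<comment> \<open>Independence is read as factorisation of the joint law: the coordinates on
    \<open>N\<close> have the law of \<open>J\<close>, which is a product because the
    \<open>Z i\<close> are independent.\<close>
  have "N.indep_vars (\<lambda>_. borel) (\<lambda>i f. f i) I"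
  proof (subst N.indep_vars_iff_distr_eq_PiM'[OF I(1) comp])
    have "distr N (\<Pi>\<^sub>M i\<in>I. borel) (\<lambda>f. \<lambda>i\<in>I. f i) = distr M (\<Pi>\<^sub>M i\<in>I. borel) ((\<lambda>f. \<lambda>i\<in>I. f i) \<circ> J)"
      unfolding N_def by (rule distr_distr) (auto intro: measurable_restrict)
    also have "\<dots> = (\<Pi>\<^sub>M i\<in>I. distr M borel (Z i))"
      using indep_vars_iff_distr_eq_PiM'[OF I(1), where X = Z and M' = "\<lambda>_. borel"] Zm indep
      by (simp add: comp_def J_def)
    also have "\<dots> = (\<Pi>\<^sub>M i\<in>I. distr N borel (\<lambda>f. f i))"
      by (intro PiM_cong) (simp_all add: comp_distr)
    finally show "distr N (\<Pi>\<^sub>M i\<in>I. borel) (\<lambda>f. \<lambda>i\<in>I. f i) = (\<Pi>\<^sub>M i\<in>I. distr N borel (\<lambda>f. f i))" .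
  qed auto
  moreover have "distr N borel (\<lambda>f. f i) = distr N borel (\<lambda>f. f 1)" if "i \<in> I" for i
    using Z that I comp_distr[of i] comp_distr[of 1] by (simp add: independent_copies_def I_def)
  ultimately have NZ: "independent_copies N n (\<lambda>i f. f i) (\<lambda>f. f 1)"
    unfolding independent_copies_def I_def[symmetric] by blast
  have W1: "distr N borel (\<lambda>f. f 1) = distr M borel W"
    using comp_distr[of 1] I Z by (simp add: independent_copies_def I_def)
  have int: "(\<integral>f. h (f 1) \<partial>N) = (\<integral>\<omega>. h (W \<omega>) \<partial>M)"
    "integrable N (\<lambda>f. h (f 1)) \<longleftrightarrow> integrable M (\<lambda>\<omega>. h (W \<omega>))"
    if "h \<in> borel_measurable borel" for h :: "real \<Rightarrow> real"
  proof -
    show "(\<integral>f. h (f 1) \<partial>N) = (\<integral>\<omega>. h (W \<omega>) \<partial>M)"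
      using integral_distr[OF comp[OF I(2)] that] integral_distr[OF W that] W1 by simp
    show "integrable N (\<lambda>f. h (f 1)) \<longleftrightarrow> integrable M (\<lambda>\<omega>. h (W \<omega>))"
      using integrable_distr_eq[OF comp[OF I(2)] that] integrable_distr_eq[OF W that] W1 by simp
  qed
  have mean: "(\<integral>f. f 1 \<partial>N) = 0" using int(1)[of "\<lambda>x. x"] W0 by simp
  have var: "N.variance (\<lambda>f. f 1) = variance W"
  proof -
    have "(\<lambda>x::real. x\<^sup>2) \<in> borel_measurable borel" by simp
    from int(1)[OF this] show ?thesis
      unfolding mean W0 diff_0_right .
  qed
  have sd: "std_dev N (\<lambda>f. f 1) = std_dev M W" unfolding std_dev_def var ..
  have varN: "N.variance (\<lambda>f. f 1) > 0" unfolding var by (rule Wv)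
  have fin: "finite_Lp_norm N 3 (\<lambda>f. f 1)"
    using int(2)[of "\<lambda>x. \<bar>x\<bar> ^ 3"] W3 comp[OF I(2)] by (simp add: finite_Lp_norm_def powr_numeral)
  let ?E = "\<lambda>x. {f \<in> space N. sqrt (real n) * ((\<Sum>i=1..n. f i) / real n) / std_dev M W \<le> x}"
  \<comment> \<open>A supremum of reals dominates its members only if they are bounded
    above.\<close>
  have bdd: "bdd_above (range (\<lambda>x. \<bar>measure N (?E x) - \<Phi> x\<bar>))"
  proof (rule bdd_aboveI2[of _ _ 1])
    fix x show "\<bar>measure N (?E x) - \<Phi> x\<bar> \<le> 1"
      using N.prob_le_1[of "?E x"] std_normal_cdf_nonneg[of x] std_normal_cdf_le_1[of x]
        measure_nonneg[of N "?E x"] by linarith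
  qed
  have "(SUP x. \<bar>measure N (?E x) - \<Phi> x\<bar>)
      \<le> c * (\<integral>f. \<bar>f 1\<bar> ^ 3 \<partial>N) / (std_dev M W ^ 3 * sqrt (real n))"
    using c[unfolded berry_esseen_constant_def, THEN conjunct2, rule_format, OF N n NZ fin mean varN]
    unfolding sd .
  moreover have "\<bar>measure N (?E x) - \<Phi> x\<bar> \<le> (SUP x. \<bar>measure N (?E x) - \<Phi> x\<bar>)"
    by (rule cSUP_upper[OF _ bdd]) simp
  moreover have spN: "J \<omega> \<in> space N" if "\<omega> \<in> space M" for \<omega>
    using measurable_space[OF J that] by (simp add: N_def)
  moreover have Jsum: "(\<Sum>i=1..n. J \<omega> i) = (\<Sum>i=1..n. Z i \<omega>)" for \<omega>
    by (rule sum.cong) (auto simp: J_def I_def)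
  moreover have "measure N (?E x) = measure M (J -` ?E x \<inter> space M)"
  proof -
    have "?E x \<in> sets N"
      using comp by measurable (auto simp: I_def)
    then show ?thesis unfolding N_def by (intro measure_distr) auto
  qed
  moreover have "J -` ?E x \<inter> space M
      = {\<omega> \<in> space M. sqrt (real n) * sample_mean n (\<lambda>i. Z i \<omega>) / std_dev M W \<le> x}"
    using spN Jsum by (auto simp: sample_mean_def)
  moreover have "(\<integral>f. \<bar>f 1\<bar> ^ 3 \<partial>N) = (\<integral>\<omega>. \<bar>W \<omega>\<bar> ^ 3 \<partial>M)"
    using int(1)[of "\<lambda>x. \<bar>x\<bar> ^ 3"] by simp
  ultimately show ?thesis by simp
qed

text \<open>Each of the two tails costs one Gaussian tail \<open>1 / sqrt n\<close> and one
  Berry--Esseen error, whence both factors 2.\<close>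

lemma berry_esseen_tail:
  fixes Z :: "nat \<Rightarrow> 'a \<Rightarrow> real"
  assumes M: "prob_space M" and c: "berry_esseen_constant c" and n: "n \<ge> 1"
    and Z: "independent_copies M n Z W" and W: "W \<in> borel_measurable M"
    and W3: "integrable M (\<lambda>\<omega>. \<bar>W \<omega>\<bar> ^ 3)" and W0: "integral\<^sup>L M W = 0"
    and Wv: "prob_space.variance M W > 0"
  shows "measure M {\<omega> \<in> space M. \<bar>sample_mean n (\<lambda>i. Z i \<omega>)\<bar> > std_dev M W * sqrt (ln (real n) / real n)}
    \<le> (2 + 2 * c * ((\<integral>\<omega>. \<bar>W \<omega>\<bar> ^ 3 \<partial>M) / std_dev M W ^ 3)) / sqrt (real n)"
proof -
  interpret prob_space M by fact
  \<comment> \<open>This \<open>u\<close> is the level for the normalised mean; the \<open>u\<close>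
    of the later sections is this one divided by \<open>sqrt n\<close>.\<close>
  define u where "u = sqrt (ln (real n))"
  define m where "m \<omega> = sample_mean n (\<lambda>i. Z i \<omega>)" for \<omega>
  let ?s = "std_dev M W"
  define A where "A \<omega> = sqrt (real n) * m \<omega> / ?s" for \<omega>
  have Zm: "Z i \<in> borel_measurable M" if "i \<in> {1..n}" for i
    using independent_copies_measurable[OF M Z that] .
  have A[measurable]: "A \<in> borel_measurable M"
    unfolding A_def m_def sample_mean_def using Zm by measurable
  define B where "B = c * (\<integral>\<omega>. \<bar>W \<omega>\<bar> ^ 3 \<partial>M) / (?s ^ 3 * sqrt (real n))"
  have BE: "\<bar>prob {\<omega> \<in> space M. A \<omega> \<le> x} - \<Phi> x\<bar> \<le> B" for x
    using berry_esseen_iid[OF assms, of x] by (simp add: A_def m_def B_def)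
  have u: "0 \<le> u" using n by (simp add: u_def)
  have s: "0 < ?s" using Wv by (simp add: std_dev_def)
  have n0: "0 < real n" using n by simp
  have eu: "exp (- u\<^sup>2 / 2) = 1 / sqrt (real n)"
  proof -
    have "exp (- u\<^sup>2 / 2) = exp (- ln (sqrt (real n)))"
      using n by (simp add: u_def ln_sqrt)
    then show ?thesis using n0 by (simp add: exp_minus inverse_eq_divide)
  qed
  have eq: "?s * sqrt (ln (real n) / real n) = u * ?s / sqrt (real n)"
    by (simp add: u_def real_sqrt_divide)
  have "{\<omega> \<in> space M. \<bar>m \<omega>\<bar> > ?s * sqrt (ln (real n) / real n)}
      \<subseteq> {\<omega> \<in> space M. A \<omega> \<le> - u} \<union> (space M - {\<omega> \<in> space M. A \<omega> \<le> u})"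
    using s n0 unfolding eq by (auto simp: A_def field_simps abs_if split: if_splits)
  then have "prob {\<omega> \<in> space M. \<bar>m \<omega>\<bar> > ?s * sqrt (ln (real n) / real n)}
      \<le> prob ({\<omega> \<in> space M. A \<omega> \<le> - u} \<union> (space M - {\<omega> \<in> space M. A \<omega> \<le> u}))"
    by (intro finite_measure_mono) auto
  also have "\<dots> \<le> prob {\<omega> \<in> space M. A \<omega> \<le> - u} + prob (space M - {\<omega> \<in> space M. A \<omega> \<le> u})"
    by (intro measure_Un_le) auto
  also have "prob (space M - {\<omega> \<in> space M. A \<omega> \<le> u}) = 1 - prob {\<omega> \<in> space M. A \<omega> \<le> u}"
    by (rule prob_compl) auto
  also have "prob {\<omega> \<in> space M. A \<omega> \<le> - u} + (1 - prob {\<omega> \<in> space M. A \<omega> \<le> u})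
      \<le> 2 / sqrt (real n) + 2 * B"
    using BE[of u] BE[of "- u"] std_normal_cdf_lower_tail[OF u] std_normal_cdf_upper_tail[OF u] eu
    by linarith
  also have "\<dots> = (2 + 2 * c * ((\<integral>\<omega>. \<bar>W \<omega>\<bar> ^ 3 \<partial>M) / ?s ^ 3)) / sqrt (real n)"
    by (simp add: B_def add_divide_distrib)
  finally show ?thesis by (simp add: m_def)
qed

lemma sample_mean_second_moment:
  fixes Z :: "nat \<Rightarrow> 'a \<Rightarrow> real"
  assumes M: "prob_space M" and n: "n \<ge> 1"
    and Z: "independent_copies M n Z W" and W: "W \<in> borel_measurable M"
    and W2: "integrable M (\<lambda>\<omega>. (W \<omega>)\<^sup>2)" and W0: "integral\<^sup>L M W = 0"
  shows "integrable M (\<lambda>\<omega>. (sample_mean n (\<lambda>i. Z i \<omega>))\<^sup>2)"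
    and "(\<integral>\<omega>. (sample_mean n (\<lambda>i. Z i \<omega>))\<^sup>2 \<partial>M) = (\<integral>\<omega>. (W \<omega>)\<^sup>2 \<partial>M) / real n"
proof -
  interpret prob_space M by fact
  have W1: "integrable M W" by (rule square_integrable_imp_integrable[OF W W2])
  have Z1: "integrable M (Z i)" "integral\<^sup>L M (Z i) = 0"
    and Z2: "integrable M (\<lambda>\<omega>. (Z i \<omega>)\<^sup>2)" "(\<integral>\<omega>. (Z i \<omega>)\<^sup>2 \<partial>M) = (\<integral>\<omega>. (W \<omega>)\<^sup>2 \<partial>M)"
    if "i \<in> {1..n}" for i
    using independent_copies_integral[OF M Z W that, of "\<lambda>x. x"] W0 W1
      independent_copies_integral[OF M Z W that, of "\<lambda>x. x\<^sup>2"] W2 by auto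
  \<comment> \<open>Off the diagonal the products have mean zero by independence, so
    \<open>n\<close> diagonal terms survive the division by \<open>n^2\<close>.\<close>
  have cross: "integrable M (\<lambda>\<omega>. Z i \<omega> * Z j \<omega>)"
    "(\<integral>\<omega>. Z i \<omega> * Z j \<omega> \<partial>M) = (if i = j then (\<integral>\<omega>. (W \<omega>)\<^sup>2 \<partial>M) else 0)"
    if ij: "i \<in> {1..n}" "j \<in> {1..n}" for i j
  proof -
    have "integrable M (\<lambda>\<omega>. Z i \<omega> * Z j \<omega>) \<and> (i \<noteq> j \<longrightarrow> (\<integral>\<omega>. Z i \<omega> * Z j \<omega> \<partial>M) = 0)"
    proof (cases "i = j")
      case True
      then show ?thesis using Z2[of i] ij by (simp add: power2_eq_square)
    next
      case False
      have ind: "indep_vars (\<lambda>_. borel) Z {i, j}"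
        using Z ij by (auto simp: independent_copies_def intro: indep_vars_subset)
      have "integrable M (Z k)" if "k \<in> {i, j}" for k using that ij Z1 by auto
      from indep_vars_lebesgue_integral[OF _ ind this] indep_vars_integrable[OF _ ind this]
      show ?thesis using False Z1 ij by simp
    qed
    then show "integrable M (\<lambda>\<omega>. Z i \<omega> * Z j \<omega>)"
      and "(\<integral>\<omega>. Z i \<omega> * Z j \<omega> \<partial>M) = (if i = j then (\<integral>\<omega>. (W \<omega>)\<^sup>2 \<partial>M) else 0)"
      using Z2(2)[of i] ij by (auto simp: power2_eq_square)
  qed
  have sq: "(sample_mean n (\<lambda>i. Z i \<omega>))\<^sup>2 = (\<Sum>i=1..n. \<Sum>j=1..n. Z i \<omega> * Z j \<omega>) / (real n)\<^sup>2" for \<omega>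
    by (simp add: sample_mean_def power_divide power2_eq_square sum_product)
  show "integrable M (\<lambda>\<omega>. (sample_mean n (\<lambda>i. Z i \<omega>))\<^sup>2)"
    unfolding sq using cross(1) by (intro integrable_divide Bochner_Integration.integrable_sum) auto
  have "(\<integral>\<omega>. (sample_mean n (\<lambda>i. Z i \<omega>))\<^sup>2 \<partial>M)
      = (\<Sum>i=1..n. \<Sum>j=1..n. (\<integral>\<omega>. Z i \<omega> * Z j \<omega> \<partial>M)) / (real n)\<^sup>2"
    unfolding sq integral_divide_zero
    by (intro arg_cong2[of _ _ _ _ "(/)"] refl trans[OF Bochner_Integration.integral_sum] sum.cong
        Bochner_Integration.integral_sum Bochner_Integration.integrable_sum cross(1)) auto
  also have "\<dots> = (\<Sum>i=1..n. \<integral>\<omega>. (W \<omega>)\<^sup>2 \<partial>M) / (real n)\<^sup>2"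
    by (intro arg_cong2[of _ _ _ _ "(/)"] sum.cong refl) (simp add: cross(2) sum.delta)
  also have "\<dots> = (\<integral>\<omega>. (W \<omega>)\<^sup>2 \<partial>M) / real n"
    by (simp add: power2_eq_square)
  finally show "(\<integral>\<omega>. (sample_mean n (\<lambda>i. Z i \<omega>))\<^sup>2 \<partial>M) = (\<integral>\<omega>. (W \<omega>)\<^sup>2 \<partial>M) / real n" .
qed

lemma sample_mean_diff: "n \<ge> 1 \<Longrightarrow> sample_mean n (\<lambda>i. z i - a) = sample_mean n z - a"
  by (simp add: sample_mean_def sum_subtractf field_simps)

text \<open>The raw second moment stands in place of the variance because \<open>H2\<close> is
  written with uncentred norms: for \<open>W\<close> the square of the centred \<open>X\<close>, its
  root is the squared fourth norm of the centred \<open>X\<close>.\<close>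

lemma sample_mean_deviation:
  fixes Z :: "nat \<Rightarrow> 'a \<Rightarrow> real"
  assumes M: "prob_space M" and n: "n \<ge> 1"
    and Z: "independent_copies M n Z W" and W: "W \<in> borel_measurable M"
    and W2: "integrable M (\<lambda>\<omega>. (W \<omega>)\<^sup>2)" and t: "0 < t"
  shows "measure M {\<omega> \<in> space M. t \<le> \<bar>sample_mean n (\<lambda>i. Z i \<omega>) - integral\<^sup>L M W\<bar>}
    \<le> (\<integral>\<omega>. (W \<omega>)\<^sup>2 \<partial>M) / (real n * t\<^sup>2)"
proof -
  interpret prob_space M by fact
  let ?\<mu> = "integral\<^sup>L M W"
  have W1: "integrable M W" by (rule square_integrable_imp_integrable[OF W W2])
  have Z': "independent_copies M n (\<lambda>i \<omega>. Z i \<omega> - ?\<mu>) (\<lambda>\<omega>. W \<omega> - ?\<mu>)"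
    using independent_copies_compose[OF M Z W, of "\<lambda>x. x - ?\<mu>"] by simp
  have W': "integrable M (\<lambda>\<omega>. (W \<omega> - ?\<mu>)\<^sup>2)" "(\<integral>\<omega>. W \<omega> - ?\<mu> \<partial>M) = 0"
    using W1 W2 by (simp_all add: power2_diff prob_space)
  have m: "sample_mean n (\<lambda>i. Z i \<omega> - ?\<mu>) = sample_mean n (\<lambda>i. Z i \<omega>) - ?\<mu>" for \<omega>
    using n by (rule sample_mean_diff)
  have [measurable]: "(\<lambda>\<omega>. sample_mean n (\<lambda>i. Z i \<omega>) - ?\<mu>) \<in> borel_measurable M"
    unfolding sample_mean_def using independent_copies_measurable[OF M Z] by measurable
  note sm = sample_mean_second_moment[OF M n Z' _ W', unfolded m]
  have "measure M {\<omega> \<in> space M. t \<le> \<bar>sample_mean n (\<lambda>i. Z i \<omega>) - ?\<mu>\<bar>}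
      \<le> (\<integral>\<omega>. (sample_mean n (\<lambda>i. Z i \<omega>) - ?\<mu>)\<^sup>2 \<partial>M) / t\<^sup>2"
    using sm(1) W t by (intro second_moment_method) auto
  also have "\<dots> = variance W / (real n * t\<^sup>2)"
    using sm(2) W by simp
  also have "\<dots> \<le> (\<integral>\<omega>. (W \<omega>)\<^sup>2 \<partial>M) / (real n * t\<^sup>2)"
    using variance_eq[OF W1 W2] n t by (intro divide_right_mono) auto
  finally show ?thesis .
qed

text \<open>Since probabilities are at most one, Chebyshev's bound \<open>a\<^sup>2 / n\<close> may be replaced by \<open>a / sqrt n\<close>.\<close>

lemma sample_mean_deviation_sqrt:
  fixes Z :: "nat \<Rightarrow> 'a \<Rightarrow> real"
  assumes M: "prob_space M" and n: "n \<ge> 1"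
    and Z: "independent_copies M n Z W" and W: "W \<in> borel_measurable M"
    and W2: "integrable M (\<lambda>\<omega>. (W \<omega>)\<^sup>2)" and t: "0 < t"
  shows "measure M {\<omega> \<in> space M. t \<le> \<bar>sample_mean n (\<lambda>i. Z i \<omega>) - integral\<^sup>L M W\<bar>}
    \<le> sqrt (\<integral>\<omega>. (W \<omega>)\<^sup>2 \<partial>M) / t / sqrt (real n)"
proof -
  interpret prob_space M by fact
  define a where "a = sqrt (\<integral>\<omega>. (W \<omega>)\<^sup>2 \<partial>M) / t / sqrt (real n)"
  have a: "0 \<le> a" "a\<^sup>2 = (\<integral>\<omega>. (W \<omega>)\<^sup>2 \<partial>M) / (real n * t\<^sup>2)"
    using t by (simp_all add: a_def power_divide power_mult_distrib)
  have "measure M {\<omega> \<in> space M. t \<le> \<bar>sample_mean n (\<lambda>i. Z i \<omega>) - integral\<^sup>L M W\<bar>} \<le> min 1 (a\<^sup>2)"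
    using sample_mean_deviation[OF assms] a by simp
  also have "\<dots> \<le> a"
    using a(1) mult_left_le[of a a] by (cases "a \<le> 1") (auto simp: power2_eq_square min_le_iff_disj)
  finally show ?thesis by (simp add: a_def)
qed

text \<open>Truncation at \<open>n * r ^ 4\<close>: only \<open>3/2\<close> moments of the averaged variables are available.\<close>

lemma sample_mean_fourth_power_tail:
  fixes Z :: "nat \<Rightarrow> 'a \<Rightarrow> real"
  assumes M: "prob_space M" and n: "n \<ge> 1"
    and Z: "independent_copies M n Z W" and W: "W \<in> borel_measurable M"
    and W4: "integrable M (\<lambda>\<omega>. W \<omega> ^ 4)" "(\<integral>\<omega>. W \<omega> ^ 4 \<partial>M) \<le> r ^ 4"
    and W6: "integrable M (\<lambda>\<omega>. W \<omega> ^ 6)" and r: "0 < r"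
  shows "measure M {\<omega> \<in> space M. 2 * r ^ 4 < sample_mean n (\<lambda>i. Z i \<omega> ^ 4)}
    \<le> 2 * (\<integral>\<omega>. W \<omega> ^ 6 \<partial>M) / r ^ 6 / sqrt (real n)"
proof -
  interpret prob_space M by fact
  \<comment> \<open>\<open>c\<close> is the truncation level for squares, so
    \<open>c^2 = n * r ^ 4\<close> is the one for fourth powers. It balances the two error events,
    each of probability at most \<open>?E6 / r ^ 6 / sqrt n\<close>.\<close>
  define c where "c = sqrt (real n) * r\<^sup>2"
  define V where "V x = (if x ^ 4 \<le> c\<^sup>2 then x ^ 4 else 0)" for x :: real
  let ?E6 = "\<integral>\<omega>. W \<omega> ^ 6 \<partial>M"
  have n0: "0 < real n" using n by simp
  have c0: "0 < c" using r n0 by (simp add: c_def)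
  have c2: "c\<^sup>2 = real n * r ^ 4" by (simp add: c_def power_mult_distrib)
  have V[measurable]: "V \<in> borel_measurable borel" unfolding V_def by measurable
  note [measurable] = independent_copies_measurable[OF M Z] W
  have ZV: "independent_copies M n (\<lambda>i \<omega>. V (Z i \<omega>)) (\<lambda>\<omega>. V (W \<omega>))"
    by (rule independent_copies_compose[OF M Z W V])
  have sq_le: "x\<^sup>2 \<le> c" if "x ^ 4 \<le> c\<^sup>2" for x :: real
    using that c0 power_mono_iff[of "x\<^sup>2" c 2] by simp
  \<comment> \<open>The truncation trades two of the eight powers for \<open>c\<close>, which brings
    the second moment of \<open>V\<close> down to the sixth moment of \<open>W\<close>.\<close>
  have V2: "(V x)\<^sup>2 \<le> c * x ^ 6" for x
  proof (cases "x ^ 4 \<le> c\<^sup>2")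
    case True
    have "x\<^sup>2 * x ^ 6 \<le> c * x ^ 6" using sq_le[OF True] by (rule mult_right_mono) simp
    then show ?thesis using True by (simp add: V_def flip: power_add power_mult)
  qed (use c0 in \<open>simp add: V_def\<close>)
  have V2i: "integrable M (\<lambda>\<omega>. (V (W \<omega>))\<^sup>2)"
    using order_trans[OF V2 abs_ge_self]
    by (intro Bochner_Integration.integrable_bound[OF integrable_mult_right[OF W6, of c]]) auto
  have EV2: "(\<integral>\<omega>. (V (W \<omega>))\<^sup>2 \<partial>M) \<le> c * ?E6"
    using integral_mono[OF V2i integrable_mult_right[OF W6, of c] V2] by simp
  have Vi: "integrable M (\<lambda>\<omega>. V (W \<omega>))"
    by (rule square_integrable_imp_integrable[OF _ V2i]) simp
  have EV: "(\<integral>\<omega>. V (W \<omega>) \<partial>M) \<le> r ^ 4"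
    by (rule order_trans[OF integral_mono[OF Vi W4(1)] W4(2)]) (simp add: V_def)
  let ?S = "\<lambda>\<omega>. sample_mean n (\<lambda>i. V (Z i \<omega>))"
  \<comment> \<open>\<open>A i\<close> contains the event that the truncation changes the
    \<open>i\<close>-th term; it is phrased with sixth powers for Markov's inequality. On
    \<open>B\<close> the truncated mean deviates by \<open>r ^ 4\<close> from an expectation that is
    itself at most \<open>r ^ 4\<close>, which explains the threshold
    \<open>2 * r ^ 4\<close>.\<close>
  define A where "A i = {\<omega> \<in> space M. c ^ 3 \<le> Z i \<omega> ^ 6}" for i
  define B where "B = {\<omega> \<in> space M. r ^ 4 \<le> \<bar>?S \<omega> - (\<integral>\<omega>. V (W \<omega>) \<partial>M)\<bar>}"
  have Ai: "A i \<in> events" if "i \<in> {1..n}" for i unfolding A_def using that by measurable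
  have Bi: "B \<in> events" unfolding B_def sample_mean_def by measurable
  have PA: "prob (A i) \<le> ?E6 / c ^ 3" if i: "i \<in> {1..n}" for i
  proof -
    note Z6 = independent_copies_integral[OF M Z W i, of "\<lambda>x. x ^ 6"]
    have "prob (A i) \<le> (\<integral>\<omega>. Z i \<omega> ^ 6 \<partial>M) / c ^ 3"
      unfolding A_def using c0 Z6 W6 i by (intro integral_Markov_inequality_measure[where A = "space M"]) auto
    then show ?thesis using Z6 by simp
  qed
  have PB: "prob B \<le> c * ?E6 / (real n * (r ^ 4)\<^sup>2)"
  proof -
    have "prob B \<le> (\<integral>\<omega>. (V (W \<omega>))\<^sup>2 \<partial>M) / (real n * (r ^ 4)\<^sup>2)"
      unfolding B_def using r by (intro sample_mean_deviation[OF M n ZV _ V2i]) auto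
    also have "\<dots> \<le> c * ?E6 / (real n * (r ^ 4)\<^sup>2)"
      using EV2 by (rule divide_right_mono) simp
    finally show ?thesis .
  qed
  have "{\<omega> \<in> space M. 2 * r ^ 4 < sample_mean n (\<lambda>i. Z i \<omega> ^ 4)} \<subseteq> (\<Union>i\<in>{1..n}. A i) \<union> B"
  proof
    fix \<omega> assume \<omega>: "\<omega> \<in> {\<omega> \<in> space M. 2 * r ^ 4 < sample_mean n (\<lambda>i. Z i \<omega> ^ 4)}"
    show "\<omega> \<in> (\<Union>i\<in>{1..n}. A i) \<union> B"
    proof (cases "\<forall>i\<in>{1..n}. Z i \<omega> ^ 4 \<le> c\<^sup>2")
      case True
      then have "sample_mean n (\<lambda>i. Z i \<omega> ^ 4) = ?S \<omega>"
        by (auto simp: sample_mean_def V_def intro!: arg_cong2[of _ _ _ _ "(/)"] sum.cong)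
      with \<omega> EV have "\<omega> \<in> B" unfolding B_def by auto
      then show ?thesis ..
    next
      case False
      then obtain i where i: "i \<in> {1..n}" "c\<^sup>2 < (Z i \<omega>)\<^sup>2 ^ 2" by (auto simp: not_le)
      then have "c < (Z i \<omega>)\<^sup>2" using power_less_imp_less_base by fastforce
      then have "c ^ 3 \<le> (Z i \<omega>)\<^sup>2 ^ 3" using c0 by (intro power_mono) auto
      then show ?thesis using i \<omega> by (auto simp: A_def)
    qed
  qed
  then have "measure M {\<omega> \<in> space M. 2 * r ^ 4 < sample_mean n (\<lambda>i. Z i \<omega> ^ 4)}
      \<le> prob ((\<Union>i\<in>{1..n}. A i) \<union> B)"
    using Ai Bi by (intro finite_measure_mono) auto
  also have "\<dots> \<le> prob (\<Union>i\<in>{1..n}. A i) + prob B"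
    using Ai Bi by (intro measure_Un_le) auto
  also have "prob (\<Union>i\<in>{1..n}. A i) \<le> (\<Sum>i\<in>{1..n}. prob (A i))"
    using Ai by (intro finite_measure_subadditive_finite) auto
  also have "\<dots> \<le> (\<Sum>i\<in>{1..n}. ?E6 / c ^ 3)"
    by (rule sum_mono[OF PA])
  also have "\<dots> = real n * (?E6 / c ^ 3)" by simp
  also have "real n * (?E6 / c ^ 3) = ?E6 / r ^ 6 / sqrt (real n)"
  proof -
    have "c ^ 3 = c\<^sup>2 * c" by (simp add: power2_eq_square power3_eq_cube)
    also have "\<dots> = real n * (r ^ 4 * r\<^sup>2 * sqrt (real n))" unfolding c2 by (simp add: c_def)
    also have "r ^ 4 * r\<^sup>2 = r ^ 6" by (simp flip: power_add)
    finally have "c ^ 3 = real n * (r ^ 6 * sqrt (real n))" .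
    then show ?thesis using n0 by simp
  qed
  also note PB
  also have "c * ?E6 / (real n * (r ^ 4)\<^sup>2) = ?E6 / r ^ 6 / sqrt (real n)"
  proof -
    have "real n * (r ^ 4)\<^sup>2 = (sqrt (real n) * sqrt (real n)) * (r\<^sup>2 * r ^ 6)"
      by (simp flip: power_mult power_add)
    then have "real n * (r ^ 4)\<^sup>2 = c * (r ^ 6 * sqrt (real n))"
      unfolding c_def by (simp only: mult_ac)
    then show ?thesis using c0 by simp
  qed
  finally show ?thesis by (simp add: mult.commute)
qed

section \<open>Moment inequalities, obtained by integrating pointwise inequalities\<close>

text \<open>Lyapunov's inequality between orders 2 and 3: \<open>2 * w^3 + s^3 - 3 * s * w^2\<close>
  has a double root at \<open>w = s\<close> and is nonnegative for \<open>w >= 0\<close>.\<close>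

lemma sqrt_second_moment_cubed_le:
  fixes W :: "'a \<Rightarrow> real"
  assumes M: "prob_space M" and "integrable M (\<lambda>\<omega>. (W \<omega>)\<^sup>2)" "integrable M (\<lambda>\<omega>. \<bar>W \<omega>\<bar> ^ 3)"
    and s: "0 \<le> s" "(\<integral>\<omega>. (W \<omega>)\<^sup>2 \<partial>M) = s\<^sup>2"
  shows "s ^ 3 \<le> (\<integral>\<omega>. \<bar>W \<omega>\<bar> ^ 3 \<partial>M)"
proof -
  interpret prob_space M by fact
  have pt: "3 * s * (W \<omega>)\<^sup>2 \<le> 2 * \<bar>W \<omega>\<bar> ^ 3 + s ^ 3" for \<omega>
  proof -
    have "0 \<le> (2 * \<bar>W \<omega>\<bar> + s) * (\<bar>W \<omega>\<bar> - s)\<^sup>2" using s by simp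
    also have "\<dots> = 2 * \<bar>W \<omega>\<bar> ^ 3 + s ^ 3 - 3 * s * \<bar>W \<omega>\<bar>\<^sup>2"
      by (simp add: power2_eq_square power3_eq_cube algebra_simps)
    finally show ?thesis by simp
  qed
  have "(\<integral>\<omega>. 3 * s * (W \<omega>)\<^sup>2 \<partial>M) \<le> (\<integral>\<omega>. 2 * \<bar>W \<omega>\<bar> ^ 3 + s ^ 3 \<partial>M)"
    using assms by (intro integral_mono pt) auto
  then show ?thesis using assms by (simp add: prob_space power2_eq_square power3_eq_cube)
qed

lemma second_moment_squared_le:
  fixes W :: "'a \<Rightarrow> real"
  assumes M: "prob_space M" and "integrable M (\<lambda>\<omega>. (W \<omega>)\<^sup>2)" "integrable M (\<lambda>\<omega>. W \<omega> ^ 4)"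
  shows "(\<integral>\<omega>. (W \<omega>)\<^sup>2 \<partial>M)\<^sup>2 \<le> (\<integral>\<omega>. W \<omega> ^ 4 \<partial>M)"
proof -
  interpret prob_space M by fact
  show ?thesis
    using variance_eq[of "\<lambda>\<omega>. (W \<omega>)\<^sup>2"] variance_positive[of "\<lambda>\<omega>. (W \<omega>)\<^sup>2"] assms by simp
qed

text \<open>Hoelder's interpolation of the second norm between the first and the fourth, with
  \<open>q\<close> the square of the fourth norm. It rests on
  \<open>a^4 - 3 * a^2 + 2 * a = a * (a + 2) * (a - 1)^2\<close>.\<close>

lemma second_moment_interpolation:
  fixes W :: "'a \<Rightarrow> real"
  assumes "integrable M (\<lambda>\<omega>. \<bar>W \<omega>\<bar>)" "integrable M (\<lambda>\<omega>. (W \<omega>)\<^sup>2)" "integrable M (\<lambda>\<omega>. W \<omega> ^ 4)"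
    and s: "0 < s" "(\<integral>\<omega>. (W \<omega>)\<^sup>2 \<partial>M) = s\<^sup>2"
    and q: "0 < q" "(\<integral>\<omega>. W \<omega> ^ 4 \<partial>M) = q\<^sup>2"
  shows "s ^ 3 \<le> q * (\<integral>\<omega>. \<bar>W \<omega>\<bar> \<partial>M)"
proof -
  have pt: "3 * (W \<omega>)\<^sup>2 \<le> 2 * (q / s) * \<bar>W \<omega>\<bar> + (s / q)\<^sup>2 * W \<omega> ^ 4" for \<omega>
  proof -
    \<comment> \<open>The unit \<open>q / s\<close> is the nonzero value of
      \<open>\<bar>W\<bar>\<close> in the case of equality, where \<open>\<bar>W\<bar>\<close> takes
      only the values 0 and \<open>q / s\<close>.\<close>
    define a where "a = s / q * \<bar>W \<omega>\<bar>"
    have a: "0 \<le> a" using s q by (simp add: a_def)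
    have W: "\<bar>W \<omega>\<bar> = a * (q / s)" using s q by (simp add: a_def)
    have "0 \<le> (q / s)\<^sup>2 * (a * ((a + 2) * (a - 1)\<^sup>2))" using a by simp
    also have "\<dots> = 2 * (q / s) * \<bar>W \<omega>\<bar> + (s / q)\<^sup>2 * \<bar>W \<omega>\<bar> ^ 4 - 3 * \<bar>W \<omega>\<bar>\<^sup>2"
      unfolding W using s q by (simp add: field_simps power2_eq_square power4_eq_xxxx)
    finally show ?thesis by simp
  qed
  have "(\<integral>\<omega>. 3 * (W \<omega>)\<^sup>2 \<partial>M) \<le> (\<integral>\<omega>. 2 * (q / s) * \<bar>W \<omega>\<bar> + (s / q)\<^sup>2 * W \<omega> ^ 4 \<partial>M)"
    using assms by (intro integral_mono pt) auto
  then have "3 * s\<^sup>2 \<le> 2 * (q / s) * (\<integral>\<omega>. \<bar>W \<omega>\<bar> \<partial>M) + (s / q)\<^sup>2 * q\<^sup>2"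
    using assms by simp
  then have "s\<^sup>2 \<le> (q / s) * (\<integral>\<omega>. \<bar>W \<omega>\<bar> \<partial>M)"
    using q by (simp add: power_divide)
  then show ?thesis using s by (simp add: field_simps power2_eq_square power3_eq_cube)
qed

text \<open>Cauchy--Schwarz by a weighted arithmetic-geometric mean inequality; the weights
  \<open>t / s\<close> and \<open>s / t\<close> make both halves integrate to the same value, and
  the majorant also supplies integrability.\<close>

lemma integral_abs_mult_le:
  fixes V W :: "'a \<Rightarrow> real"
  assumes "V \<in> borel_measurable M" "W \<in> borel_measurable M"
    and "integrable M (\<lambda>\<omega>. (V \<omega>)\<^sup>2)" "integrable M (\<lambda>\<omega>. (W \<omega>)\<^sup>2)"
    and s: "0 < s" "(\<integral>\<omega>. (V \<omega>)\<^sup>2 \<partial>M) = s\<^sup>2" and t: "0 < t" "(\<integral>\<omega>. (W \<omega>)\<^sup>2 \<partial>M) = t\<^sup>2"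
  shows "integrable M (\<lambda>\<omega>. V \<omega> * W \<omega>)" and "(\<integral>\<omega>. \<bar>V \<omega> * W \<omega>\<bar> \<partial>M) \<le> s * t"
proof -
  let ?g = "\<lambda>\<omega>. (t / s * (V \<omega>)\<^sup>2 + s / t * (W \<omega>)\<^sup>2) / 2"
  have pt: "\<bar>V \<omega> * W \<omega>\<bar> \<le> ?g \<omega>" for \<omega>
  proof -
    have "0 \<le> (t * \<bar>V \<omega>\<bar> - s * \<bar>W \<omega>\<bar>)\<^sup>2 / (s * t)" using s t by simp
    also have "\<dots> = t / s * \<bar>V \<omega>\<bar>\<^sup>2 + s / t * \<bar>W \<omega>\<bar>\<^sup>2 - 2 * (\<bar>V \<omega>\<bar> * \<bar>W \<omega>\<bar>)"
      using s t by (simp add: field_simps power2_eq_square)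
    finally show ?thesis by (simp add: abs_mult)
  qed
  have g: "integrable M ?g" using assms by auto
  show i: "integrable M (\<lambda>\<omega>. V \<omega> * W \<omega>)"
    using pt assms by (intro Bochner_Integration.integrable_bound[OF g]) (auto intro: order_trans)
  have "(\<integral>\<omega>. \<bar>V \<omega> * W \<omega>\<bar> \<partial>M) \<le> (\<integral>\<omega>. ?g \<omega> \<partial>M)"
    using i g pt by (intro integral_mono) auto
  also have "\<dots> = s * t" using assms by (simp add: power2_eq_square)
  finally show "(\<integral>\<omega>. \<bar>V \<omega> * W \<omega>\<bar> \<partial>M) \<le> s * t" .
qed

text \<open>Applied to the square of \<open>X \<epsilon>\<close>, it replaces the central third
  moment of Berry--Esseen by the uncentred sixth norm in \<open>H2\<close>, without loss of a
  constant. The slope \<open>m\<^sup>2\<close> of the linear correction is the one giving pointwise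
  equality at \<open>V = 0\<close>.\<close>

lemma third_central_moment_le:
  fixes V :: "'a \<Rightarrow> real"
  assumes M: "prob_space M" and V: "V \<in> borel_measurable M" "\<And>\<omega>. 0 \<le> V \<omega>"
    and V1: "integrable M V" and V3: "integrable M (\<lambda>\<omega>. V \<omega> ^ 3)"
  shows "integrable M (\<lambda>\<omega>. \<bar>V \<omega> - integral\<^sup>L M V\<bar> ^ 3)"
    and "(\<integral>\<omega>. \<bar>V \<omega> - integral\<^sup>L M V\<bar> ^ 3 \<partial>M) \<le> (\<integral>\<omega>. V \<omega> ^ 3 \<partial>M)"
proof -
  interpret prob_space M by fact
  define m where "m = integral\<^sup>L M V"
  have m: "0 \<le> m" unfolding m_def using V by simp
  let ?g = "\<lambda>\<omega>. V \<omega> ^ 3 - m\<^sup>2 * (V \<omega> - m)"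
  \<comment> \<open>The linear term has mean zero.\<close>
  have pt: "\<bar>V \<omega> - m\<bar> ^ 3 \<le> ?g \<omega>" for \<omega>
  proof -
    define v where "v = V \<omega>"
    have v: "0 \<le> v" using V by (simp add: v_def)
    have "\<bar>v - m\<bar> ^ 3 \<le> v ^ 3 - m\<^sup>2 * (v - m)"
    proof (cases "m \<le> v")
      case True
      have "0 \<le> m * (3 * (v - 2 / 3 * m)\<^sup>2 + 2 / 3 * m\<^sup>2)" using m by simp
      also have "\<dots> = v ^ 3 - m\<^sup>2 * (v - m) - (v - m) ^ 3"
        by (simp add: power2_eq_square power3_eq_cube field_simps)
      finally show ?thesis using True by simp
    next
      case False
      have "0 \<le> v * (2 * (v - 3 / 4 * m)\<^sup>2 + 7 / 8 * m\<^sup>2)" using v by simp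
      also have "\<dots> = v ^ 3 - m\<^sup>2 * (v - m) - (m - v) ^ 3"
        by (simp add: power2_eq_square power3_eq_cube field_simps)
      finally show ?thesis using False by (simp add: abs_if)
    qed
    then show ?thesis by (simp add: v_def)
  qed
  have g: "integrable M ?g" using V1 V3 by auto
  have i: "integrable M (\<lambda>\<omega>. \<bar>V \<omega> - m\<bar> ^ 3)"
    using order_trans[OF pt abs_ge_self] V(1) by (intro Bochner_Integration.integrable_bound[OF g]) auto
  have "(\<integral>\<omega>. \<bar>V \<omega> - m\<bar> ^ 3 \<partial>M) \<le> (\<integral>\<omega>. ?g \<omega> \<partial>M)"
    using i g pt by (rule integral_mono)
  also have "\<dots> = (\<integral>\<omega>. V \<omega> ^ 3 \<partial>M)"
    using V1 V3 by (simp add: prob_space m_def)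
  finally show "(\<integral>\<omega>. \<bar>V \<omega> - integral\<^sup>L M V\<bar> ^ 3 \<partial>M) \<le> (\<integral>\<omega>. V \<omega> ^ 3 \<partial>M)"
    by (simp add: m_def)
  show "integrable M (\<lambda>\<omega>. \<bar>V \<omega> - integral\<^sup>L M V\<bar> ^ 3)" using i by (simp add: m_def)
qed

section \<open>The studentised slope as a perturbed normalised sum\<close>

lemma sample_mean_add: "sample_mean n (\<lambda>i. f i + g i) = sample_mean n f + sample_mean n g"
  by (simp add: sample_mean_def sum.distrib add_divide_distrib)

lemma sample_mean_minus: "sample_mean n (\<lambda>i. f i - g i) = sample_mean n f - sample_mean n g"
  by (simp add: sample_mean_def sum_subtractf diff_divide_distrib)

lemma sample_mean_cmult: "sample_mean n (\<lambda>i. c * f i) = c * sample_mean n f"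
  by (simp add: sample_mean_def flip: sum_distrib_left)

lemma sample_mean_multc: "sample_mean n (\<lambda>i. f i * c) = sample_mean n f * c"
  by (simp add: sample_mean_def flip: sum_distrib_right)

lemma sample_mean_const: "n \<ge> 1 \<Longrightarrow> sample_mean n (\<lambda>i. c) = c"
  by (simp add: sample_mean_def)

lemmas sample_mean_linear =
  sample_mean_add sample_mean_minus sample_mean_cmult sample_mean_multc sample_mean_const

lemma sample_mean_mono: "(\<And>i. f i \<le> g i) \<Longrightarrow> sample_mean n f \<le> sample_mean n g"
  by (simp add: sample_mean_def divide_right_mono sum_mono)

lemma sample_mean_nonneg: "(\<And>i. 0 \<le> f i) \<Longrightarrow> 0 \<le> sample_mean n f"
  by (simp add: sample_mean_def sum_nonneg)

lemma sample_covariance: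
  assumes "n \<ge> 1"
  shows "sample_mean n (\<lambda>i. (x i - sample_mean n x) * (y i - sample_mean n y))
    = sample_mean n (\<lambda>i. x i * y i) - sample_mean n x * sample_mean n y"
  using assms by (simp add: sample_mean_linear algebra_simps)

lemma sample_mean_squared_le:
  assumes "n \<ge> 1" shows "(sample_mean n x)\<^sup>2 \<le> sample_mean n (\<lambda>i. (x i)\<^sup>2)"
proof -
  have "0 \<le> sample_mean n (\<lambda>i. (x i - sample_mean n x) * (x i - sample_mean n x))"
    by (intro sample_mean_nonneg) simp
  then show ?thesis
    unfolding sample_covariance[OF assms] by (simp add: power2_eq_square)
qed

section \<open>The empirical second norm and the algebra of the estimators\<close>

text \<open>Stated through \<open>sample_mean\<close> so that bounds on empirical moments apply
  directly; \<open>rms_eq\<close> connects it with \<open>L2_set\<close>, whose triangle inequality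
  is Minkowski's.\<close>

definition rms :: "nat \<Rightarrow> (nat \<Rightarrow> real) \<Rightarrow> real" where
  "rms n z = sqrt (sample_mean n (\<lambda>i. (z i)\<^sup>2))"

lemma rms_eq: "rms n z = L2_set z {1..n} / sqrt (real n)"
  by (simp add: rms_def sample_mean_def L2_set_def real_sqrt_divide)

lemma rms_nonneg [simp]: "0 \<le> rms n z"
  by (simp add: rms_eq)

lemma rms_triangle: "rms n (\<lambda>i. f i + g i) \<le> rms n f + rms n g"
  unfolding rms_eq add_divide_distrib[symmetric]
  by (intro divide_right_mono L2_set_triangle_ineq) simp

lemma rms_cmult: "rms n (\<lambda>i. c * f i) = \<bar>c\<bar> * rms n f"
  by (simp add: rms_def power_mult_distrib sample_mean_cmult real_sqrt_mult)

lemma rms_const: "n \<ge> 1 \<Longrightarrow> rms n (\<lambda>i. c) = \<bar>c\<bar>"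
  by (simp add: rms_def sample_mean_const)

lemma rms_perturb: "\<bar>rms n f - rms n g\<bar> \<le> rms n (\<lambda>i. f i - g i)"
proof -
  have "rms n f \<le> rms n g + rms n (\<lambda>i. f i - g i)"
    using rms_triangle[of n g "\<lambda>i. f i - g i"] by simp
  moreover have "rms n g \<le> rms n f + rms n (\<lambda>i. (-1) * (f i - g i))"
    using rms_triangle[of n f "\<lambda>i. (-1) * (f i - g i)"] by simp
  moreover have "rms n (\<lambda>i. (-1) * (f i - g i)) = rms n (\<lambda>i. f i - g i)"
    unfolding rms_cmult by simp
  ultimately show ?thesis by linarith
qed

text \<open>Convexity gives \<open>(a - c)^4 <= 8 * a^4 + 8 * c^4\<close>, and the fourth power of
  the mean is at most the mean of the fourth powers. The two eights add up to 16, whose root is the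
  4.\<close>

lemma rms_centred_square_le:
  assumes "n \<ge> 1"
  shows "rms n (\<lambda>i. (x i - sample_mean n x)\<^sup>2) \<le> 4 * sqrt (sample_mean n (\<lambda>i. x i ^ 4))"
proof -
  let ?b = "sample_mean n x" and ?f = "sample_mean n (\<lambda>i. x i ^ 4)"
  have "?b ^ 4 = (?b\<^sup>2)\<^sup>2" by simp
  also have "\<dots> \<le> (sample_mean n (\<lambda>i. (x i)\<^sup>2))\<^sup>2"
    by (intro power_mono sample_mean_squared_le assms) simp
  also have "\<dots> \<le> ?f"
    using sample_mean_squared_le[OF assms, of "\<lambda>i. (x i)\<^sup>2"] by simp
  finally have b: "?b ^ 4 \<le> ?f" .
  have pt: "((a - c)\<^sup>2)\<^sup>2 \<le> 8 * a ^ 4 + 8 * c ^ 4" for a c :: real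
  proof -
    have "(a - c)\<^sup>2 \<le> 2 * a\<^sup>2 + 2 * c\<^sup>2"
      using zero_le_power2[of "a + c"] by (simp add: power2_sum power2_diff)
    then have "((a - c)\<^sup>2)\<^sup>2 \<le> (2 * a\<^sup>2 + 2 * c\<^sup>2)\<^sup>2" by (intro power_mono) auto
    also have "\<dots> \<le> 2 * (2 * a\<^sup>2)\<^sup>2 + 2 * (2 * c\<^sup>2)\<^sup>2"
      using zero_le_power2[of "2 * a\<^sup>2 - 2 * c\<^sup>2"]
      unfolding power2_sum[of "2 * a\<^sup>2"] power2_diff[of "2 * a\<^sup>2"] by linarith
    finally show ?thesis by (simp add: power_mult_distrib)
  qed
  have "sample_mean n (\<lambda>i. ((x i - ?b)\<^sup>2)\<^sup>2) \<le> sample_mean n (\<lambda>i. 8 * x i ^ 4 + 8 * ?b ^ 4)"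
    by (intro sample_mean_mono pt)
  also have "\<dots> = 8 * ?f + 8 * ?b ^ 4"
    unfolding sample_mean_add sample_mean_cmult using assms by (simp add: sample_mean_const)
  also have "\<dots> \<le> 4\<^sup>2 * ?f" using b by simp
  finally have "rms n (\<lambda>i. (x i - ?b)\<^sup>2) \<le> sqrt (4\<^sup>2 * ?f)"
    unfolding rms_def by simp
  then show ?thesis by (simp add: real_sqrt_mult)
qed

text \<open>A shift of the data is absorbed by the intercept, which reduces the theorem to centred
  variables. The default values match too, since no denominator changes.\<close>

lemma studentised_slope_shift:
  assumes "n \<ge> 1"
  shows "studentised_slope d d' d'' t n (\<lambda>i. x i - a) (\<lambda>i. y i - b) = studentised_slope d d' d'' t n x y"
proof -
  note m = sample_mean_diff[OF assms]
  have "slope_hat d n (\<lambda>i. x i - a) (\<lambda>i. y i - b) = slope_hat d n x y"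
    by (simp add: slope_hat_def m)
  moreover from this have "residual d n (\<lambda>i. x i - a) (\<lambda>i. y i - b) = residual d n x y"
    by (simp add: fun_eq_iff residual_def intercept_hat_def m algebra_simps)
  ultimately show ?thesis
    by (simp add: studentised_slope_def v_hat_def m)
qed

text \<open>\<open>R / S\<close> is the estimation error of the slope and \<open>V\<^sup>2\<close> the numerator of the variance estimator.\<close>

lemma studentised_slope_eq:
  fixes x y :: "nat \<Rightarrow> real" and t :: real
  assumes n: "n \<ge> 1"
  defines "e \<equiv> \<lambda>i. y i - t * x i"
  defines "S \<equiv> sample_mean n (\<lambda>i. (x i)\<^sup>2) - (sample_mean n x)\<^sup>2"
  defines "R \<equiv> sample_mean n (\<lambda>i. x i * e i) - sample_mean n x * sample_mean n e"
  defines "V \<equiv> rms n (\<lambda>i. (x i - sample_mean n x) *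
      (e i - sample_mean n e - R / S * (x i - sample_mean n x)))"
  assumes S: "0 < S" and V: "0 < V"
  shows "studentised_slope d d' d'' t n x y = sqrt (real n) * R / V"
proof -
  let ?xb = "sample_mean n x" and ?yb = "sample_mean n y" and ?eb = "sample_mean n e"
  have n0: "0 < real n" using n by simp
  have eb: "?eb = ?yb - t * ?xb" by (simp add: e_def sample_mean_linear)
  have sum_eq: "(\<Sum>i=1..n. f i) = real n * sample_mean n f" for f
    using n0 by (simp add: sample_mean_def)
  have Sx: "(\<Sum>i=1..n. (x i - ?xb)\<^sup>2) = real n * S"
    unfolding sum_eq S_def power2_eq_square sample_covariance[OF n] ..
  have "R + t * S = sample_mean n (\<lambda>i. x i * y i) - ?xb * ?yb"
    by (simp add: R_def S_def e_def eb sample_mean_linear algebra_simps power2_eq_square)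
  then have Sxy: "(\<Sum>i=1..n. (x i - ?xb) * (y i - ?yb)) = real n * (R + t * S)"
    unfolding sum_eq sample_covariance[OF n] by simp
  have slope: "slope_hat d n x y = t + R / S"
    unfolding slope_hat_def ratio_def Sx Sxy using S n0 by (simp add: add_divide_distrib)
  have res: "residual d n x y i = e i - ?eb - R / S * (x i - ?xb)" for i
    unfolding residual_def intercept_hat_def slope eb by (simp add: e_def algebra_simps)
  have "(\<Sum>i=1..n. (x i - ?xb)\<^sup>2 * (residual d n x y i)\<^sup>2) / real n = V\<^sup>2"
    unfolding V_def rms_def res
    by (simp add: sample_mean_def power_mult_distrib sum_nonneg)
  then have "v_hat d d' n x y = V\<^sup>2 / S\<^sup>2"
    unfolding v_hat_def ratio_def Sx using S n0 by simp
  \<comment> \<open>The factor \<open>S\<close> cancels against the one in the slope error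
    \<open>R / S\<close>, so \<open>V\<close> alone remains in the denominator.\<close>
  then have "sqrt (v_hat d d' n x y) = V / S"
    using S V by (simp add: real_sqrt_divide)
  then show ?thesis
    using S V by (simp add: studentised_slope_def ratio_def slope)
qed

text \<open>\<open>D\<close> is left free; it will be the estimation error \<open>R / S\<close> of
  the slope. Only the fourth summand contains it, and there a fourth empirical moment is the
  price.\<close>

lemma rms_residual_perturb:
  fixes x e :: "nat \<Rightarrow> real"
  assumes n: "n \<ge> 1"
  shows "\<bar>rms n (\<lambda>i. (x i - sample_mean n x) * (e i - sample_mean n e - D * (x i - sample_mean n x)))
      - rms n (\<lambda>i. x i * e i)\<bar>
    \<le> \<bar>sample_mean n x\<bar> * rms n e + \<bar>sample_mean n e\<bar> * rms n x
      + \<bar>sample_mean n x\<bar> * \<bar>sample_mean n e\<bar> + \<bar>D\<bar> * (4 * sqrt (sample_mean n (\<lambda>i. x i ^ 4)))"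
proof -
  let ?a = "sample_mean n x" and ?b = "sample_mean n e"
  let ?r = "\<lambda>i. (x i - ?a) * (e i - ?b - D * (x i - ?a))"
  have "\<bar>rms n ?r - rms n (\<lambda>i. x i * e i)\<bar> \<le> rms n (\<lambda>i. ?r i - x i * e i)"
    by (rule rms_perturb)
  also have "(\<lambda>i. ?r i - x i * e i)
      = (\<lambda>i. ((- ?a) * e i + (- ?b) * x i) + ((?a * ?b) + (- D) * (x i - ?a)\<^sup>2))"
    by (simp add: fun_eq_iff power2_eq_square algebra_simps)
  also have "rms n \<dots> \<le> (rms n (\<lambda>i. (- ?a) * e i) + rms n (\<lambda>i. (- ?b) * x i))
      + (rms n (\<lambda>i. ?a * ?b) + rms n (\<lambda>i. (- D) * (x i - ?a)\<^sup>2))"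
    by (intro order_trans[OF rms_triangle] add_mono rms_triangle)
  also have "\<dots> = \<bar>?a\<bar> * rms n e + \<bar>?b\<bar> * rms n x + \<bar>?a\<bar> * \<bar>?b\<bar> + \<bar>D\<bar> * rms n (\<lambda>i. (x i - ?a)\<^sup>2)"
    unfolding rms_cmult rms_const[OF n] by (simp add: abs_mult)
  also have "\<dots> \<le> \<bar>?a\<bar> * rms n e + \<bar>?b\<bar> * rms n x + \<bar>?a\<bar> * \<bar>?b\<bar>
      + \<bar>D\<bar> * (4 * sqrt (sample_mean n (\<lambda>i. x i ^ 4)))"
    by (intro add_left_mono mult_left_mono rms_centred_square_le n) simp
  finally show ?thesis .
qed

text \<open>The deterministic half of the argument, for one realisation outside the exceptional
  event. The hypotheses \<open>k1\<close>, \<open>k2\<close>, \<open>k3\<close> are consequences of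
  the minimum defining \<open>K\<close>, and the two inequalities \<open>q\<close> are the
  interpolations.\<close>

lemma studentisation_error:
  fixes sX sY sE s q r K u t :: real and x y :: "nat \<Rightarrow> real"
  assumes n: "n \<ge> 1"
    and pos: "0 < sX" "0 < sY" "0 \<le> sE" "0 < s" "0 < q" "0 < K" "0 \<le> u"
    and sE: "sE \<le> sY" and t: "\<bar>t\<bar> * sX \<le> sY"
    and k1: "4 * q * K \<le> s\<^sup>2" and k2: "288 * K * (sX * sY)\<^sup>2 \<le> s\<^sup>2"
    and k3: "1152 * K * r ^ 4 * sY \<le> s * sX ^ 3"
    and q: "s\<^sup>2 \<le> q" "s ^ 3 \<le> sX * sY * q"
    and uK: "8 * u \<le> 9 * K"
  defines "e \<equiv> \<lambda>i. y i - t * x i"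
  defines "S \<equiv> sample_mean n (\<lambda>i. (x i)\<^sup>2) - (sample_mean n x)\<^sup>2"
  defines "R \<equiv> sample_mean n (\<lambda>i. x i * e i) - sample_mean n x * sample_mean n e"
  defines "V \<equiv> rms n (\<lambda>i. (x i - sample_mean n x) *
      (e i - sample_mean n e - R / S * (x i - sample_mean n x)))"
  assumes xb: "\<bar>sample_mean n x\<bar> \<le> u * sX" and eb: "\<bar>sample_mean n e\<bar> \<le> u * sE"
    and xe: "\<bar>sample_mean n (\<lambda>i. x i * e i)\<bar> \<le> u * s"
    and xe2: "\<bar>sample_mean n (\<lambda>i. (x i * e i)\<^sup>2) - s\<^sup>2\<bar> \<le> u * q"
    and x2: "\<bar>sample_mean n (\<lambda>i. (x i)\<^sup>2) - sX\<^sup>2\<bar> \<le> sX\<^sup>2 / 4"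
    and y2: "sample_mean n (\<lambda>i. (y i)\<^sup>2) \<le> 5 / 4 * sY\<^sup>2"
    and x4: "sample_mean n (\<lambda>i. x i ^ 4) \<le> 2 * r ^ 4"
  shows "0 < S" and "\<bar>V - s\<bar> \<le> u / (2 * K) * s"
proof -
  let ?xb = "sample_mean n x" and ?eb = "sample_mean n e"
  \<comment> \<open>The goal is an error of \<open>w / 2\<close>: a quarter of \<open>w\<close> for
    the fluctuation of the mean of \<open>(x e)^2\<close>, and a quarter for the passage from errors
    to residuals.\<close>
  define w where "w = u * s / K"
  have w: "0 \<le> w" using pos by (simp add: w_def)
  have K4: "4 * K \<le> 1"
  proof -
    have "q * (4 * K) \<le> q * 1" using k1 q by simp
    then show ?thesis using pos by (simp only: mult_le_cancel_left_pos)
  qed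
  have u: "u \<le> 9 / 32" using uK K4 by linarith
  \<comment> \<open>33 is the largest integer whose square, divided by 4, stays below 288; the 4
    comes from \<open>4 * K <= 1\<close>.\<close>
  have pK: "33 * K * (sX * sY) \<le> s"
  proof (rule power2_le_imp_le)
    have "(33 * K * (sX * sY))\<^sup>2 = 1089 * K * (K * (sX * sY)\<^sup>2)"
      by (simp add: power2_eq_square)
    also have "\<dots> \<le> 1089 * (1 / 4) * (K * (sX * sY)\<^sup>2)"
      using K4 pos by (intro mult_right_mono) auto
    also have "\<dots> \<le> 288 * K * (sX * sY)\<^sup>2" using pos by simp
    also note k2
    finally show "(33 * K * (sX * sY))\<^sup>2 \<le> s\<^sup>2" .
  qed (use pos in simp)
  \<comment> \<open>Multiplying \<open>k1\<close> by \<open>k3\<close> and inserting the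
    interpolation for \<open>s ^ 3\<close> lets \<open>q * sY\<close> cancel, with the constant
    \<open>4 * 1152 = 4608\<close>; 67 is the integer part of its root.\<close>
  have rK: "67 * K * r\<^sup>2 \<le> sX\<^sup>2"
  proof (rule power2_le_imp_le)
    have "(4 * q * K) * (1152 * K * r ^ 4 * sY) \<le> s\<^sup>2 * (s * sX ^ 3)"
      using pos by (intro mult_mono[OF k1 k3]) auto
    also have "\<dots> = s ^ 3 * sX ^ 3" by (simp add: power2_eq_square power3_eq_cube)
    also have "\<dots> \<le> (sX * sY * q) * sX ^ 3" using q pos by (intro mult_right_mono) auto
    finally have "(q * sY) * (4608 * K\<^sup>2 * r ^ 4) \<le> (q * sY) * sX ^ 4"
      by (simp add: power2_eq_square power3_eq_cube power4_eq_xxxx algebra_simps)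
    then have "4608 * K\<^sup>2 * r ^ 4 \<le> sX ^ 4"
      using pos by (simp only: mult_le_cancel_left_pos mult_pos_pos)
    moreover have "(67 * K * r\<^sup>2)\<^sup>2 \<le> 4608 * K\<^sup>2 * r ^ 4"
      by (simp add: power_mult_distrib flip: power_mult)
    ultimately show "(67 * K * r\<^sup>2)\<^sup>2 \<le> (sX\<^sup>2)\<^sup>2" by simp
  qed simp
  have upw: "u * (sX * sY) \<le> w / 33"
  proof -
    have "u * (33 * K * (sX * sY)) \<le> u * s" using pK pos by (intro mult_left_mono) auto
    then show ?thesis using pos by (simp add: w_def field_simps)
  qed
  have ws: "w \<le> 9 / 8 * s"
  proof -
    have "8 * u * s \<le> 9 * K * s" using uK pos by (intro mult_right_mono) auto
    then show ?thesis using pos by (simp add: w_def field_simps)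
  qed
  have u2: "u\<^sup>2 \<le> 8 / 100"
    using power_mono[OF u pos(7), of 2] by (simp add: power2_eq_square)
  have xb2: "?xb\<^sup>2 \<le> 8 / 100 * sX\<^sup>2"
  proof -
    have "?xb\<^sup>2 \<le> (u * sX)\<^sup>2"
      using power_mono[OF xb, of 2] by simp
    also have "\<dots> \<le> 8 / 100 * sX\<^sup>2"
      unfolding power_mult_distrib using u2 by (intro mult_right_mono) auto
    finally show ?thesis .
  qed
  \<comment> \<open>\<open>67 / 100\<close> is \<open>3 / 4 - 8 / 100\<close>.\<close>
  have S: "67 / 100 * sX\<^sup>2 \<le> S" unfolding S_def using x2 xb2 by linarith
  have sX2: "0 < sX\<^sup>2" using pos by simp
  show "0 < S" using S sX2 by linarith

  have xeb: "\<bar>?xb\<bar> * \<bar>?eb\<bar> \<le> u * (u * (sX * sY))"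
  proof -
    have "\<bar>?xb\<bar> * \<bar>?eb\<bar> \<le> (u * sX) * (u * sY)"
      using xb eb sE pos by (intro mult_mono order_trans[OF eb] mult_left_mono) auto
    then show ?thesis by (simp add: mult_ac)
  qed
  have R: "\<bar>R\<bar> \<le> 104 / 100 * (u * s)"
  proof -
    have "\<bar>R\<bar> \<le> \<bar>sample_mean n (\<lambda>i. x i * e i)\<bar> + \<bar>?xb\<bar> * \<bar>?eb\<bar>"
      unfolding R_def abs_mult[symmetric] by (rule abs_triangle_ineq4)
    also have "\<dots> \<le> u * s + u * (u * (sX * sY))" using xe xeb by linarith
    \<comment> \<open>By \<open>upw\<close> and \<open>ws\<close>, \<open>u * (sX * sY)\<close> is
      at most \<open>9 / (8 * 33)\<close> times \<open>s\<close>, which is below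
      \<open>4 / 100\<close>.\<close>
    also have "\<dots> \<le> u * s + u * (4 / 100 * s)"
      using upw ws pos by (intro add_left_mono mult_left_mono) auto
    finally show ?thesis by (simp add: mult_ac)
  qed
  have D: "\<bar>R / S\<bar> * r\<^sup>2 \<le> 104 / 67 * (w / 67)"
  proof -
    have "\<bar>R / S\<bar> * r\<^sup>2 = \<bar>R\<bar> * (r\<^sup>2 / S)" using \<open>0 < S\<close> by (simp add: abs_divide)
    also have "\<dots> \<le> (104 / 100 * (u * s)) * (1 / (67 * K) / (67 / 100))"
    proof (intro mult_mono)
      have "(67 * K) * (67 / 100) * r\<^sup>2 \<le> 67 / 100 * sX\<^sup>2" using rK by simp
      also note S
      finally show "r\<^sup>2 / S \<le> 1 / (67 * K) / (67 / 100)"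
        using \<open>0 < S\<close> pos by (simp add: field_simps)
    qed (use R \<open>0 < S\<close> pos in auto)
    also have "\<dots> = 104 / 67 * (w / 67)" by (simp add: w_def)
    finally show ?thesis .
  qed

  have c: "sqrt (5 / 4) \<le> 112 / 100" by (rule real_le_lsqrt) (auto simp: power2_eq_square)
  have rx: "rms n x \<le> 112 / 100 * sX"
  proof -
    have "rms n x \<le> sqrt (5 / 4 * sX\<^sup>2)" unfolding rms_def using x2 by (intro real_sqrt_le_mono) linarith
    also have "\<dots> = sqrt (5 / 4) * sX" using pos by (simp only: real_sqrt_mult real_sqrt_abs abs_of_pos)
    also have "\<dots> \<le> 112 / 100 * sX" using c pos by (intro mult_right_mono) auto
    finally show ?thesis .
  qed
  have ry: "rms n y \<le> 112 / 100 * sY"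
  proof -
    have "rms n y \<le> sqrt (5 / 4 * sY\<^sup>2)" unfolding rms_def using y2 by (rule real_sqrt_le_mono)
    also have "\<dots> = sqrt (5 / 4) * sY" using pos by (simp only: real_sqrt_mult real_sqrt_abs abs_of_pos)
    also have "\<dots> \<le> 112 / 100 * sY" using c pos by (intro mult_right_mono) auto
    finally show ?thesis .
  qed
  have re: "rms n e \<le> 224 / 100 * sY"
  proof -
    have "rms n e \<le> rms n y + rms n (\<lambda>i. (- t) * x i)"
      using rms_triangle[of n y "\<lambda>i. (- t) * x i"] by (simp add: e_def)
    also have "rms n (\<lambda>i. (- t) * x i) = \<bar>t\<bar> * rms n x" by (simp only: rms_cmult abs_minus_cancel)
    also have "\<dots> \<le> \<bar>t\<bar> * (112 / 100 * sX)" using rx by (rule mult_left_mono) simp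
    also have "\<dots> \<le> 112 / 100 * sY" using t by (simp add: mult_ac)
    finally show ?thesis using ry by linarith
  qed
  have r4: "sqrt (sample_mean n (\<lambda>i. x i ^ 4)) \<le> 142 / 100 * r\<^sup>2"
  proof -
    have "(142 / 100 * r\<^sup>2)\<^sup>2 = 20164 / 10000 * r ^ 4" by (simp add: power2_eq_square power4_eq_xxxx)
    moreover have "0 \<le> r ^ 4" by simp
    ultimately have "2 * r ^ 4 \<le> (142 / 100 * r\<^sup>2)\<^sup>2" by linarith
    then show ?thesis using x4 by (intro real_le_lsqrt) auto
  qed

  have main: "\<bar>rms n (\<lambda>i. x i * e i) - s\<bar> \<le> w / 4"
  proof -
    define a where "a = rms n (\<lambda>i. x i * e i)"
    have a: "0 \<le> a" "a\<^sup>2 = sample_mean n (\<lambda>i. (x i * e i)\<^sup>2)"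
      by (auto simp: a_def rms_def intro: sample_mean_nonneg)
    \<comment> \<open>Passing to squares avoids the root: division by \<open>a + s >= s\<close>
      turns the error of the mean square into that of its root.\<close>
    have "\<bar>a - s\<bar> * s \<le> \<bar>a - s\<bar> * (a + s)" using a by (intro mult_left_mono) auto
    also have "\<dots> = \<bar>(a - s) * (a + s)\<bar>" using a(1) pos(4) by (simp add: abs_mult)
    also have "(a - s) * (a + s) = a\<^sup>2 - s\<^sup>2" by (simp add: power2_eq_square algebra_simps)
    also have "\<bar>a\<^sup>2 - s\<^sup>2\<bar> \<le> u * q" using xe2 a by simp
    also have "\<dots> \<le> (w / 4) * s"
    proof -
      have "u * (4 * q * K) \<le> u * s\<^sup>2" using k1 pos by (intro mult_left_mono) auto
      then show ?thesis using pos by (simp add: w_def field_simps power2_eq_square)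
    qed
    finally show ?thesis using pos unfolding a_def by simp
  qed
  have "\<bar>V - rms n (\<lambda>i. x i * e i)\<bar> \<le> \<bar>?xb\<bar> * rms n e + \<bar>?eb\<bar> * rms n x
      + \<bar>?xb\<bar> * \<bar>?eb\<bar> + \<bar>R / S\<bar> * (4 * sqrt (sample_mean n (\<lambda>i. x i ^ 4)))"
    unfolding V_def by (rule rms_residual_perturb[OF n])
  also have "\<dots> \<le> 224 / 100 * (w / 33) + 112 / 100 * (w / 33) + 9 / 32 * (w / 33) + 568 / 100 * (104 / 67 * (w / 67))"
  proof (intro add_mono)
    have "\<bar>?xb\<bar> * rms n e \<le> (u * sX) * (224 / 100 * sY)"
      using xb re pos by (intro mult_mono) auto
    then show "\<bar>?xb\<bar> * rms n e \<le> 224 / 100 * (w / 33)" using upw by (simp add: mult_ac)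
    have "\<bar>?eb\<bar> * rms n x \<le> (u * sY) * (112 / 100 * sX)"
      using order_trans[OF eb mult_left_mono[OF sE pos(7)]] rx pos by (intro mult_mono) auto
    then show "\<bar>?eb\<bar> * rms n x \<le> 112 / 100 * (w / 33)" using upw by (simp add: mult_ac)
    have "u * (u * (sX * sY)) \<le> 9 / 32 * (w / 33)"
      using u upw pos by (intro mult_mono) auto
    then show "\<bar>?xb\<bar> * \<bar>?eb\<bar> \<le> 9 / 32 * (w / 33)" using xeb by linarith
    have "\<bar>R / S\<bar> * (4 * sqrt (sample_mean n (\<lambda>i. x i ^ 4))) \<le> \<bar>R / S\<bar> * (4 * (142 / 100 * r\<^sup>2))"
      using r4 by (intro mult_left_mono) auto
    also have "\<dots> = 568 / 100 * (\<bar>R / S\<bar> * r\<^sup>2)" by simp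
    finally show "\<bar>R / S\<bar> * (4 * sqrt (sample_mean n (\<lambda>i. x i ^ 4))) \<le> 568 / 100 * (104 / 67 * (w / 67))"
      using D by linarith
  qed
  \<comment> \<open>The numerical coefficients add up to about 0.242.\<close>
  also have "\<dots> \<le> w / 4" using w by simp
  finally have "\<bar>V - rms n (\<lambda>i. x i * e i)\<bar> \<le> w / 4" .
  with main have "\<bar>V - s\<bar> \<le> w / 2" by linarith
  then show "\<bar>V - s\<bar> \<le> u / (2 * K) * s" by (simp add: w_def)
qed

section \<open>Normal approximation\<close>

lemma borel_measurable_sample_mean:
  assumes "\<And>i. i \<in> {1..n} \<Longrightarrow> (\<lambda>\<omega>. f i \<omega>) \<in> borel_measurable M"
  shows "(\<lambda>\<omega>. sample_mean n (\<lambda>i. f i \<omega>)) \<in> borel_measurable M"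
  unfolding sample_mean_def using assms by measurable

lemma borel_measurable_ratio [measurable (raw)]:
  assumes [measurable]: "f \<in> borel_measurable M" "g \<in> borel_measurable M"
  shows "(\<lambda>\<omega>. ratio d (f \<omega>) (g \<omega>)) \<in> borel_measurable M"
  unfolding ratio_def by measurable

lemma borel_measurable_studentised_slope:
  assumes X: "\<And>i. i \<in> {1..n} \<Longrightarrow> X i \<in> borel_measurable M"
    and Y: "\<And>i. i \<in> {1..n} \<Longrightarrow> Y i \<in> borel_measurable M"
  shows "(\<lambda>\<omega>. studentised_slope d d' d'' t n (\<lambda>i. X i \<omega>) (\<lambda>i. Y i \<omega>)) \<in> borel_measurable M"
proof -
  note [measurable] = X Y
  have [measurable]: "(\<lambda>\<omega>. sample_mean n (\<lambda>i. X i \<omega>)) \<in> borel_measurable M"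
    "(\<lambda>\<omega>. sample_mean n (\<lambda>i. Y i \<omega>)) \<in> borel_measurable M"
    by (intro borel_measurable_sample_mean X Y; assumption)+
  have [measurable]: "(\<lambda>\<omega>. slope_hat d n (\<lambda>i. X i \<omega>) (\<lambda>i. Y i \<omega>)) \<in> borel_measurable M"
    unfolding slope_hat_def by measurable
  have [measurable]: "(\<lambda>\<omega>. residual d n (\<lambda>i. X i \<omega>) (\<lambda>i. Y i \<omega>) i) \<in> borel_measurable M"
    if "i \<in> {1..n}" for i
    using X[OF that] Y[OF that] unfolding residual_def intercept_hat_def by measurable
  have [measurable]: "(\<lambda>\<omega>. v_hat d d' n (\<lambda>i. X i \<omega>) (\<lambda>i. Y i \<omega>)) \<in> borel_measurable M"
    unfolding v_hat_def by measurable
  show ?thesis unfolding studentised_slope_def by measurable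
qed

text \<open>On the complement of the exceptional event the statistic is a shifted and rescaled normalised
  sum.\<close>

lemma normal_approx_perturb:
  fixes A T :: "'a \<Rightarrow> real"
  assumes M: "prob_space M"
    and [measurable]: "A \<in> borel_measurable M" "T \<in> borel_measurable M" "B \<in> sets M"
    and A: "\<And>x. \<bar>measure M {\<omega> \<in> space M. A \<omega> \<le> x} - \<Phi> x\<bar> \<le> b"
    and \<delta>: "0 \<le> \<delta>" "\<delta> < 1" and \<eta>: "0 \<le> \<eta>"
    and T: "\<And>\<omega>. \<omega> \<in> space M \<Longrightarrow> \<omega> \<notin> B \<Longrightarrow>
      \<exists>z w. T \<omega> = (A \<omega> - z) / w \<and> \<bar>z\<bar> \<le> \<eta> \<and> \<bar>w - 1\<bar> \<le> \<delta>"
  shows "\<bar>measure M {\<omega> \<in> space M. T \<omega> \<le> x} - \<Phi> x\<bar>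
    \<le> (\<eta> + \<delta> / ((1 - \<delta>) * sqrt 2)) / sqrt (2 * pi) + b + measure M B"
proof -
  interpret prob_space M by fact
  let ?h = "\<delta> * \<bar>x\<bar> + \<eta>"
  let ?g = "(\<eta> + \<delta> / ((1 - \<delta>) * sqrt 2)) / sqrt (2 * pi)"
  have "0 \<le> \<delta> * \<bar>x\<bar>" using \<delta> by simp
  note h = this add_nonneg_nonneg[OF this \<eta>]
  have TA: "T \<omega> \<le> x \<Longrightarrow> A \<omega> \<le> x + ?h" "A \<omega> \<le> x - ?h \<Longrightarrow> T \<omega> \<le> x"
    if \<omega>: "\<omega> \<in> space M" "\<omega> \<notin> B" for \<omega>
  proof -
    obtain z w where zw: "T \<omega> = (A \<omega> - z) / w" "\<bar>z\<bar> \<le> \<eta>" "\<bar>w - 1\<bar> \<le> \<delta>"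
      using T[OF \<omega>] by blast
    have "\<bar>(w - 1) * x\<bar> \<le> \<delta> * \<bar>x\<bar>" unfolding abs_mult using zw by (intro mult_right_mono) auto
    then have wx: "x * w \<le> x + \<delta> * \<bar>x\<bar>" "x - \<delta> * \<bar>x\<bar> \<le> x * w"
      by (auto simp: algebra_simps abs_le_iff)
    have "0 < w" using zw \<delta> by linarith
    \<comment> \<open>Moving the scale \<open>w\<close> to the side of \<open>x\<close> leaves a
      threshold for \<open>A\<close> that differs from \<open>x\<close> by at most
      \<open>\<delta> * \<bar>x\<bar> + \<eta>\<close>.\<close>
    then have "T \<omega> \<le> x \<longleftrightarrow> A \<omega> - z \<le> x * w" by (simp add: zw field_simps)
    then show "T \<omega> \<le> x \<Longrightarrow> A \<omega> \<le> x + ?h" "A \<omega> \<le> x - ?h \<Longrightarrow> T \<omega> \<le> x"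
      using wx zw(2) by linarith+
  qed
  have "prob {\<omega> \<in> space M. T \<omega> \<le> x} \<le> prob ({\<omega> \<in> space M. A \<omega> \<le> x + ?h} \<union> B)"
    using TA by (intro finite_measure_mono) auto
  also have "\<dots> \<le> prob {\<omega> \<in> space M. A \<omega> \<le> x + ?h} + prob B"
    by (intro measure_Un_le) auto
  finally have upper: "prob {\<omega> \<in> space M. T \<omega> \<le> x} \<le> prob {\<omega> \<in> space M. A \<omega> \<le> x + ?h} + prob B" .
  have "prob {\<omega> \<in> space M. A \<omega> \<le> x - ?h} \<le> prob ({\<omega> \<in> space M. T \<omega> \<le> x} \<union> B)"
    using TA by (intro finite_measure_mono) auto
  also have "\<dots> \<le> prob {\<omega> \<in> space M. T \<omega> \<le> x} + prob B"
    by (intro measure_Un_le) auto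
  finally have lower: "prob {\<omega> \<in> space M. A \<omega> \<le> x - ?h} \<le> prob {\<omega> \<in> space M. T \<omega> \<le> x} + prob B" .
  have h': "\<bar>x + ?h - x\<bar> \<le> ?h" "\<bar>x - (x - ?h)\<bar> \<le> ?h"
    using abs_of_nonneg[OF h(2)] by simp_all
  have "x \<le> x + ?h" "x - ?h \<le> x" using h by linarith+
  then have "\<Phi> (x + ?h) - \<Phi> x \<le> ?g" "\<Phi> x - \<Phi> (x - ?h) \<le> ?g"
    using std_normal_cdf_perturb[OF \<delta> \<eta> h'(1)] std_normal_cdf_perturb[OF \<delta> \<eta> h'(2)] by blast+
  then show ?thesis
    using upper lower A[of "x + ?h"] A[of "x - ?h"] by (simp add: abs_le_iff)
qed

text \<open>The probabilistic half, for centred variables. The norms enter as real parameters tied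
  to moments, which separates the estimates from the definitions of the constants. The four
  Berry--Esseen tails give the 8, and the coefficient 3 of the \<open>X E\<close> term is 2 from its
  tail plus 1 from the approximation of the main sum.\<close>

lemma studentised_slope_normal_approx:
  fixes X Y E :: "'a \<Rightarrow> real" and Xs Ys :: "nat \<Rightarrow> 'a \<Rightarrow> real"
    and n :: nat and c t sX sY sE s v q r K u :: real
  assumes M: "prob_space M" and c: "berry_esseen_constant c" and n: "n \<ge> 1"
    and [measurable]: "X \<in> borel_measurable M" "Y \<in> borel_measurable M"
    and P: "independent_copies M n (\<lambda>i \<omega>. (Xs i \<omega>, Ys i \<omega>)) (\<lambda>\<omega>. (X \<omega>, Y \<omega>))"
    and E_def: "E = (\<lambda>\<omega>. Y \<omega> - t * X \<omega>)"
    and mean: "integral\<^sup>L M X = 0" "integral\<^sup>L M E = 0" "(\<integral>\<omega>. X \<omega> * E \<omega> \<partial>M) = 0"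
    and pos: "0 < sX" "0 < sY" "0 < sE" "0 < s" "0 < v" "0 < q" "0 < r" "0 < K"
    and X2: "(\<integral>\<omega>. (X \<omega>)\<^sup>2 \<partial>M) = sX\<^sup>2" and Y2: "(\<integral>\<omega>. (Y \<omega>)\<^sup>2 \<partial>M) = sY\<^sup>2"
    and E2: "(\<integral>\<omega>. (E \<omega>)\<^sup>2 \<partial>M) = sE\<^sup>2" and XE2: "(\<integral>\<omega>. (X \<omega> * E \<omega>)\<^sup>2 \<partial>M) = s\<^sup>2"
    and XE4: "integrable M (\<lambda>\<omega>. (X \<omega> * E \<omega>) ^ 4)" "(\<integral>\<omega>. (X \<omega> * E \<omega>) ^ 4 \<partial>M) = q\<^sup>2"
    and v: "prob_space.variance M (\<lambda>\<omega>. (X \<omega> * E \<omega>)\<^sup>2) = v\<^sup>2"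
    and X4: "integrable M (\<lambda>\<omega>. X \<omega> ^ 4)" "(\<integral>\<omega>. X \<omega> ^ 4 \<partial>M) = r ^ 4"
    and Y4: "integrable M (\<lambda>\<omega>. Y \<omega> ^ 4)"
    and X6: "integrable M (\<lambda>\<omega>. X \<omega> ^ 6)" and XE6: "integrable M (\<lambda>\<omega>. (X \<omega> * E \<omega>) ^ 6)"
    and X3: "integrable M (\<lambda>\<omega>. \<bar>X \<omega>\<bar> ^ 3)" and E3: "integrable M (\<lambda>\<omega>. \<bar>E \<omega>\<bar> ^ 3)"
    and XE3: "integrable M (\<lambda>\<omega>. \<bar>X \<omega> * E \<omega>\<bar> ^ 3)"
    and sE: "sE \<le> sY" and t: "\<bar>t\<bar> * sX \<le> sY"
    and k1: "4 * q * K \<le> s\<^sup>2" and k2: "288 * K * (sX * sY)\<^sup>2 \<le> s\<^sup>2"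
    and k3: "1152 * K * r ^ 4 * sY \<le> s * sX ^ 3"
    and q: "s\<^sup>2 \<le> q" "s ^ 3 \<le> sX * sY * q"
    and u_def: "u = sqrt (ln (real n) / real n)"
    and uK: "8 * u \<le> 9 * K"
  shows "\<bar>measure M {\<omega> \<in> space M. studentised_slope d d' d'' t n (\<lambda>i. Xs i \<omega>) (\<lambda>i. Ys i \<omega>) \<le> x} - \<Phi> x\<bar>
    \<le> (sqrt (real n) * u\<^sup>2 * (sX * sE) / s + u / K) / sqrt (2 * pi)
      + (8 + 3 * c * ((\<integral>\<omega>. \<bar>X \<omega> * E \<omega>\<bar> ^ 3 \<partial>M) / s ^ 3) + 2 * c * ((\<integral>\<omega>. \<bar>E \<omega>\<bar> ^ 3 \<partial>M) / sE ^ 3)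
        + 2 * c * ((\<integral>\<omega>. \<bar>X \<omega>\<bar> ^ 3 \<partial>M) / sX ^ 3) + 2 * c * ((\<integral>\<omega>. (X \<omega> * E \<omega>) ^ 6 \<partial>M) / v ^ 3)
        + 4 * (r\<^sup>2 / sX\<^sup>2) + 4 * (sqrt (\<integral>\<omega>. Y \<omega> ^ 4 \<partial>M) / sY\<^sup>2)
        + 2 * ((\<integral>\<omega>. X \<omega> ^ 6 \<partial>M) / r ^ 6)) / sqrt (real n)"
proof -
  interpret prob_space M by fact
  have n0: "0 < real n" using n by simp
  have u0: "0 \<le> u" using n by (simp add: u_def)
  have c0: "0 < c" using c by (simp add: berry_esseen_constant_def)
  have E[measurable]: "E \<in> borel_measurable M" unfolding E_def by measurable
  define Es where "Es i \<omega> = Ys i \<omega> - t * Xs i \<omega>" for i \<omega>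
  have PW: "(\<lambda>\<omega>. (X \<omega>, Y \<omega>)) \<in> borel_measurable M" by measurable
  \<comment> \<open>Every sequence of copies below is an image of the pairs, so the joint
    independence of the pairs is all that is ever invoked.\<close>
  note copy = independent_copies_compose[OF M P PW]
  have cX: "independent_copies M n Xs X"
    using copy[of fst] by (simp add: borel_measurable_continuous_onI continuous_on_fst)
  have cY: "independent_copies M n Ys Y"
    using copy[of snd] by (simp add: borel_measurable_continuous_onI continuous_on_snd)
  have cE: "independent_copies M n Es E"
    using copy[of "\<lambda>p. snd p - t * fst p"] unfolding Es_def E_def
    by (simp add: borel_measurable_continuous_onI continuous_intros)
  have cXE: "independent_copies M n (\<lambda>i \<omega>. Xs i \<omega> * Es i \<omega>) (\<lambda>\<omega>. X \<omega> * E \<omega>)"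
    using copy[of "\<lambda>p. fst p * (snd p - t * fst p)"] unfolding Es_def E_def
    by (simp add: borel_measurable_continuous_onI continuous_intros)
  have cX2: "independent_copies M n (\<lambda>i \<omega>. (Xs i \<omega>)\<^sup>2) (\<lambda>\<omega>. (X \<omega>)\<^sup>2)"
    by (rule independent_copies_compose[OF M cX]) auto
  have cY2: "independent_copies M n (\<lambda>i \<omega>. (Ys i \<omega>)\<^sup>2) (\<lambda>\<omega>. (Y \<omega>)\<^sup>2)"
    by (rule independent_copies_compose[OF M cY]) auto
  have cXE2: "independent_copies M n (\<lambda>i \<omega>. (Xs i \<omega> * Es i \<omega>)\<^sup>2 - s\<^sup>2) (\<lambda>\<omega>. (X \<omega> * E \<omega>)\<^sup>2 - s\<^sup>2)"
    by (rule independent_copies_compose[OF M cXE]) auto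
  note meas = independent_copies_measurable[OF M cX] independent_copies_measurable[OF M cY]
    independent_copies_measurable[OF M cE]
  note [measurable] = meas
  have XE2i: "integrable M (\<lambda>\<omega>. (X \<omega> * E \<omega>)\<^sup>2)"
    by (rule square_integrable_imp_integrable) (use XE4(1) in \<open>simp_all flip: power_mult\<close>)

  have sd: "std_dev M X = sX" "std_dev M E = sE" "std_dev M (\<lambda>\<omega>. X \<omega> * E \<omega>) = s"
    using pos by (simp_all add: std_dev_def mean X2 E2 XE2)
  have var: "variance X > 0" "variance E > 0" "variance (\<lambda>\<omega>. X \<omega> * E \<omega>) > 0"
    using pos by (simp_all add: mean X2 E2 XE2)
  have V0: "(\<integral>\<omega>. (X \<omega> * E \<omega>)\<^sup>2 - s\<^sup>2 \<partial>M) = 0"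
    using XE2i by (simp add: XE2 prob_space)
  have Vv: "variance (\<lambda>\<omega>. (X \<omega> * E \<omega>)\<^sup>2 - s\<^sup>2) = v\<^sup>2"
    unfolding V0 using v unfolding XE2 by simp
  have sdV: "std_dev M (\<lambda>\<omega>. (X \<omega> * E \<omega>)\<^sup>2 - s\<^sup>2) = v"
    unfolding std_dev_def Vv using pos by simp
  \<comment> \<open>The tail bound for the squares is at \<open>v * u\<close>, while
    \<open>studentisation_error\<close> is stated with \<open>q\<close>, the root of the uncentred
    fourth moment.\<close>
  have vq: "v \<le> q"
  proof (rule power2_le_imp_le)
    have "v\<^sup>2 = q\<^sup>2 - (s\<^sup>2)\<^sup>2"
      using variance_eq[OF XE2i] XE4 unfolding v unfolding XE2 by (simp flip: power_mult)
    then show "v\<^sup>2 \<le> q\<^sup>2" by simp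
  qed (use pos in simp)
  have XE6': "integrable M (\<lambda>\<omega>. ((X \<omega> * E \<omega>)\<^sup>2) ^ 3)"
    using XE6 by (simp flip: power_mult)
  have V3: "integrable M (\<lambda>\<omega>. \<bar>(X \<omega> * E \<omega>)\<^sup>2 - s\<^sup>2\<bar> ^ 3)"
    "(\<integral>\<omega>. \<bar>(X \<omega> * E \<omega>)\<^sup>2 - s\<^sup>2\<bar> ^ 3 \<partial>M) \<le> (\<integral>\<omega>. (X \<omega> * E \<omega>) ^ 6 \<partial>M)"
    using third_central_moment_le[OF M _ _ XE2i XE6'] unfolding XE2 by (simp_all flip: power_mult)

  let ?m = "\<lambda>f \<omega>. sample_mean n (\<lambda>i. f i \<omega>)"
  define B1 where "B1 = {\<omega> \<in> space M. \<bar>?m Xs \<omega>\<bar> > sX * u}"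
  define B2 where "B2 = {\<omega> \<in> space M. \<bar>?m Es \<omega>\<bar> > sE * u}"
  define B3 where "B3 = {\<omega> \<in> space M. \<bar>?m (\<lambda>i \<omega>. Xs i \<omega> * Es i \<omega>) \<omega>\<bar> > s * u}"
  define B4 where "B4 = {\<omega> \<in> space M. \<bar>?m (\<lambda>i \<omega>. (Xs i \<omega> * Es i \<omega>)\<^sup>2 - s\<^sup>2) \<omega>\<bar> > v * u}"
  define B5 where "B5 = {\<omega> \<in> space M. sX\<^sup>2 / 4 \<le> \<bar>?m (\<lambda>i \<omega>. (Xs i \<omega>)\<^sup>2) \<omega> - sX\<^sup>2\<bar>}"
  define B6 where "B6 = {\<omega> \<in> space M. sY\<^sup>2 / 4 \<le> \<bar>?m (\<lambda>i \<omega>. (Ys i \<omega>)\<^sup>2) \<omega> - sY\<^sup>2\<bar>}"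
  define B7 where "B7 = {\<omega> \<in> space M. 2 * r ^ 4 < ?m (\<lambda>i \<omega>. Xs i \<omega> ^ 4) \<omega>}"
  define B where "B = B1 \<union> B2 \<union> B3 \<union> B4 \<union> B5 \<union> B6 \<union> B7"
  have Bm[measurable]: "B1 \<in> events" "B2 \<in> events" "B3 \<in> events" "B4 \<in> events" "B5 \<in> events"
    "B6 \<in> events" "B7 \<in> events"
    unfolding B1_def B2_def B3_def B4_def B5_def B6_def B7_def sample_mean_def by measurable
  have B1: "prob B1 \<le> (2 + 2 * c * ((\<integral>\<omega>. \<bar>X \<omega>\<bar> ^ 3 \<partial>M) / sX ^ 3)) / sqrt (real n)"
    using berry_esseen_tail[OF M c n cX _ X3 mean(1) var(1)] unfolding B1_def u_def sd by simp
  have B2: "prob B2 \<le> (2 + 2 * c * ((\<integral>\<omega>. \<bar>E \<omega>\<bar> ^ 3 \<partial>M) / sE ^ 3)) / sqrt (real n)"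
    using berry_esseen_tail[OF M c n cE E E3 mean(2) var(2)] unfolding B2_def u_def sd .
  have B3: "prob B3 \<le> (2 + 2 * c * ((\<integral>\<omega>. \<bar>X \<omega> * E \<omega>\<bar> ^ 3 \<partial>M) / s ^ 3)) / sqrt (real n)"
    using berry_esseen_tail[OF M c n cXE _ XE3 mean(3) var(3)] unfolding B3_def u_def sd by simp
  have "prob B4 \<le> (2 + 2 * c * ((\<integral>\<omega>. \<bar>(X \<omega> * E \<omega>)\<^sup>2 - s\<^sup>2\<bar> ^ 3 \<partial>M) / v ^ 3)) / sqrt (real n)"
    using berry_esseen_tail[OF M c n cXE2 _ V3(1) V0] pos(5) unfolding B4_def u_def sdV Vv by simp
  also have "\<dots> \<le> (2 + 2 * c * ((\<integral>\<omega>. (X \<omega> * E \<omega>) ^ 6 \<partial>M) / v ^ 3)) / sqrt (real n)"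
    using V3(2) pos c0 by (intro divide_right_mono add_left_mono mult_left_mono) auto
  finally have B4: "prob B4 \<le> \<dots>" .
  have B5: "prob B5 \<le> 4 * (r\<^sup>2 / sX\<^sup>2) / sqrt (real n)"
  proof -
    have "sqrt (\<integral>\<omega>. ((X \<omega>)\<^sup>2)\<^sup>2 \<partial>M) = r\<^sup>2"
      using X4(2) by (intro real_sqrt_unique) (simp_all flip: power_mult)
    moreover have "integrable M (\<lambda>\<omega>. ((X \<omega>)\<^sup>2)\<^sup>2)" using X4(1) by (simp flip: power_mult)
    ultimately show ?thesis
      using sample_mean_deviation_sqrt[OF M n cX2, of "sX\<^sup>2 / 4"] pos(1)
      unfolding B5_def X2 by (simp add: mult_ac)
  qed
  have B6: "prob B6 \<le> 4 * (sqrt (\<integral>\<omega>. Y \<omega> ^ 4 \<partial>M) / sY\<^sup>2) / sqrt (real n)"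
  proof -
    have "integrable M (\<lambda>\<omega>. ((Y \<omega>)\<^sup>2)\<^sup>2)" using Y4(1) by (simp flip: power_mult)
    then show ?thesis
      using sample_mean_deviation_sqrt[OF M n cY2, of "sY\<^sup>2 / 4"] pos(2)
      unfolding B6_def Y2 by (simp add: mult_ac flip: power_mult)
  qed
  have B7: "prob B7 \<le> 2 * ((\<integral>\<omega>. X \<omega> ^ 6 \<partial>M) / r ^ 6) / sqrt (real n)"
    using sample_mean_fourth_power_tail[OF M n cX _ X4(1) _ X6 pos(7)] X4(2) unfolding B7_def by simp
  have "prob B \<le> prob B1 + prob B2 + prob B3 + prob B4 + prob B5 + prob B6 + prob B7"
    unfolding B_def by (intro order_trans[OF measure_Un_le] add_mono) auto

  have collect: "g + c * a / m + ((2 + 2 * c * a1) / m + (2 + 2 * c * a2) / m + (2 + 2 * c * a) / m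
      + (2 + 2 * c * a4) / m + a5 / m + a6 / m + a7 / m)
    = g + (8 + 3 * c * a + 2 * c * a2 + 2 * c * a1 + 2 * c * a4 + a5 + a6 + a7) / m"
    for g a m a1 a2 a4 a5 a6 a7 :: real
    by (simp flip: add_divide_distrib)

  define A where "A \<omega> = sqrt (real n) * ?m (\<lambda>i \<omega>. Xs i \<omega> * Es i \<omega>) \<omega> / s" for \<omega>
  let ?T = "\<lambda>\<omega>. studentised_slope d d' d'' t n (\<lambda>i. Xs i \<omega>) (\<lambda>i. Ys i \<omega>)"
  define b where "b = c * ((\<integral>\<omega>. \<bar>X \<omega> * E \<omega>\<bar> ^ 3 \<partial>M) / s ^ 3) / sqrt (real n)"
  define \<delta> where "\<delta> = u / (2 * K)"
  define \<eta> where "\<eta> = sqrt (real n) * u\<^sup>2 * (sX * sE) / s"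
  have \<delta>: "0 \<le> \<delta>" "\<delta> \<le> 9 / 16" using uK pos u0 by (auto simp: \<delta>_def field_simps)
  have "\<bar>prob {\<omega> \<in> space M. ?T \<omega> \<le> x} - \<Phi> x\<bar>
      \<le> (\<eta> + \<delta> / ((1 - \<delta>) * sqrt 2)) / sqrt (2 * pi) + b + prob B"
  proof (rule normal_approx_perturb[OF M])
    show "A \<in> borel_measurable M" unfolding A_def sample_mean_def by measurable
    show "?T \<in> borel_measurable M" by (intro borel_measurable_studentised_slope meas)
    show "B \<in> events" unfolding B_def by measurable
    show "\<bar>prob {\<omega> \<in> space M. A \<omega> \<le> x} - \<Phi> x\<bar> \<le> b" for x
      using berry_esseen_iid[OF M c n cXE _ XE3 mean(3) var(3), of x] unfolding sd A_def b_def by simp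
    show "0 \<le> \<eta>" using pos by (simp add: \<eta>_def)
    show "0 \<le> \<delta>" "\<delta> < 1" using \<delta> by auto
    fix \<omega> assume \<omega>: "\<omega> \<in> space M" "\<omega> \<notin> B"
    define S where "S = sample_mean n (\<lambda>i. (Xs i \<omega>)\<^sup>2) - (sample_mean n (\<lambda>i. Xs i \<omega>))\<^sup>2"
    define R where "R = sample_mean n (\<lambda>i. Xs i \<omega> * Es i \<omega>) - ?m Xs \<omega> * ?m Es \<omega>"
    define V where "V = rms n (\<lambda>i. (Xs i \<omega> - ?m Xs \<omega>) *
      (Es i \<omega> - ?m Es \<omega> - R / S * (Xs i \<omega> - ?m Xs \<omega>)))"
    have 1: "\<bar>?m Xs \<omega>\<bar> \<le> u * sX" using \<omega> by (simp add: B_def B1_def mult.commute)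
    have 2: "\<bar>?m Es \<omega>\<bar> \<le> u * sE" using \<omega> by (simp add: B_def B2_def mult.commute)
    have 3: "\<bar>sample_mean n (\<lambda>i. Xs i \<omega> * Es i \<omega>)\<bar> \<le> u * s"
      using \<omega> by (simp add: B_def B3_def mult.commute)
    have "\<bar>sample_mean n (\<lambda>i. (Xs i \<omega> * Es i \<omega>)\<^sup>2) - s\<^sup>2\<bar> \<le> u * v"
      using \<omega> n by (simp add: B_def B4_def mult.commute sample_mean_diff)
    also have "\<dots> \<le> u * q" using vq u0 by (rule mult_left_mono)
    finally have 4: "\<bar>sample_mean n (\<lambda>i. (Xs i \<omega> * Es i \<omega>)\<^sup>2) - s\<^sup>2\<bar> \<le> u * q" .
    have 5: "\<bar>sample_mean n (\<lambda>i. (Xs i \<omega>)\<^sup>2) - sX\<^sup>2\<bar> \<le> sX\<^sup>2 / 4"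
      using \<omega> by (simp add: B_def B5_def)
    have "\<bar>sample_mean n (\<lambda>i. (Ys i \<omega>)\<^sup>2) - sY\<^sup>2\<bar> < sY\<^sup>2 / 4"
      using \<omega> by (simp add: B_def B6_def)
    then have 6: "sample_mean n (\<lambda>i. (Ys i \<omega>)\<^sup>2) \<le> 5 / 4 * sY\<^sup>2" by linarith
    have 7: "sample_mean n (\<lambda>i. Xs i \<omega> ^ 4) \<le> 2 * r ^ 4"
      using \<omega> by (simp add: B_def B7_def)
    note err = studentisation_error[OF n pos(1,2) less_imp_le[OF pos(3)] pos(4,6,8) u0 sE t k1 k2 k3 q uK,
        of "\<lambda>i. Xs i \<omega>" "\<lambda>i. Ys i \<omega>", folded Es_def, folded S_def R_def, folded V_def, OF 1 2 3 4 5 6 7]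
    have S: "0 < S" by (rule err(1))
    have Vs: "\<bar>V - s\<bar> \<le> \<delta> * s" using err(2) by (simp add: \<delta>_def)
    have "\<delta> * s < s" using \<delta> pos by simp
    then have V: "0 < V" using Vs by linarith
    have "?T \<omega> = sqrt (real n) * R / V"
      using studentised_slope_eq[OF n, where x = "\<lambda>i. Xs i \<omega>" and y = "\<lambda>i. Ys i \<omega>" and t = t,
          folded Es_def, folded S_def R_def, folded V_def, OF S V] .
    \<comment> \<open>The product of the two means becomes the shift and \<open>V / s\<close>
      becomes the scale.\<close>
    also have "\<dots> = (A \<omega> - sqrt (real n) * (?m Xs \<omega> * ?m Es \<omega>) / s) / (V / s)"
      using pos(4) V by (simp add: A_def R_def field_simps)
    finally have T: "?T \<omega> = \<dots>" .
    have "\<bar>?m Xs \<omega>\<bar> * \<bar>?m Es \<omega>\<bar> \<le> (u * sX) * (u * sE)"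
      using 1 2 u0 pos by (intro mult_mono) auto
    then have z: "\<bar>sqrt (real n) * (?m Xs \<omega> * ?m Es \<omega>) / s\<bar> \<le> \<eta>"
      using pos n0 by (simp add: \<eta>_def abs_mult divide_right_mono power2_eq_square mult_ac)
    have w: "\<bar>V / s - 1\<bar> \<le> \<delta>"
    proof -
      have "V / s - 1 = (V - s) / s" using pos by (simp add: diff_divide_distrib)
      then have "\<bar>V / s - 1\<bar> = \<bar>V - s\<bar> / s" using pos by (simp add: abs_divide)
      then show ?thesis using Vs pos by (simp add: pos_divide_le_eq)
    qed
    show "\<exists>z w. ?T \<omega> = (A \<omega> - z) / w \<and> \<bar>z\<bar> \<le> \<eta> \<and> \<bar>w - 1\<bar> \<le> \<delta>"
      using T z w by blast
  qed
  also have "\<dots> \<le> (\<eta> + u / K) / sqrt (2 * pi) + b + prob B"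
  proof -
    \<comment> \<open>With \<open>\<delta> <= 9 / 16\<close>, the denominator
      \<open>(1 - \<delta>) * sqrt 2\<close> is at least \<open>35 / 64 > 1 / 2\<close>; doubling
      \<open>\<delta> = u / (2 * K)\<close> gives \<open>u / K\<close>.\<close>
    have "5 / 4 \<le> sqrt 2" by (rule real_le_rsqrt) (simp add: power2_eq_square)
    then have "7 / 16 * (5 / 4) \<le> (1 - \<delta>) * sqrt 2" using \<delta> by (intro mult_mono) auto
    then have "\<delta> / ((1 - \<delta>) * sqrt 2) \<le> \<delta> / (1 / 2)" using \<delta> by (intro divide_left_mono) auto
    then show ?thesis by (simp add: \<delta>_def divide_right_mono)
  qed
  also have "(\<eta> + u / K) / sqrt (2 * pi) + b + prob B \<le> (\<eta> + u / K) / sqrt (2 * pi) + b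
      + ((2 + 2 * c * ((\<integral>\<omega>. \<bar>X \<omega>\<bar> ^ 3 \<partial>M) / sX ^ 3)) / sqrt (real n)
      + (2 + 2 * c * ((\<integral>\<omega>. \<bar>E \<omega>\<bar> ^ 3 \<partial>M) / sE ^ 3)) / sqrt (real n)
      + (2 + 2 * c * ((\<integral>\<omega>. \<bar>X \<omega> * E \<omega>\<bar> ^ 3 \<partial>M) / s ^ 3)) / sqrt (real n)
      + (2 + 2 * c * ((\<integral>\<omega>. (X \<omega> * E \<omega>) ^ 6 \<partial>M) / v ^ 3)) / sqrt (real n)
      + 4 * (r\<^sup>2 / sX\<^sup>2) / sqrt (real n)
      + 4 * (sqrt (\<integral>\<omega>. Y \<omega> ^ 4 \<partial>M) / sY\<^sup>2) / sqrt (real n)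
      + 2 * ((\<integral>\<omega>. X \<omega> ^ 6 \<partial>M) / r ^ 6) / sqrt (real n))"
    using \<open>prob B \<le> _\<close> B1 B2 B3 B4 B5 B6 B7 by linarith
  also have "\<dots> = (\<eta> + u / K) / sqrt (2 * pi)
      + (8 + 3 * c * ((\<integral>\<omega>. \<bar>X \<omega> * E \<omega>\<bar> ^ 3 \<partial>M) / s ^ 3) + 2 * c * ((\<integral>\<omega>. \<bar>E \<omega>\<bar> ^ 3 \<partial>M) / sE ^ 3)
        + 2 * c * ((\<integral>\<omega>. \<bar>X \<omega>\<bar> ^ 3 \<partial>M) / sX ^ 3) + 2 * c * ((\<integral>\<omega>. (X \<omega> * E \<omega>) ^ 6 \<partial>M) / v ^ 3)
        + 4 * (r\<^sup>2 / sX\<^sup>2) + 4 * (sqrt (\<integral>\<omega>. Y \<omega> ^ 4 \<partial>M) / sY\<^sup>2)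
        + 2 * ((\<integral>\<omega>. X \<omega> ^ 6 \<partial>M) / r ^ 6)) / sqrt (real n)"
    unfolding b_def by (rule collect)
  finally show ?thesis by (simp add: \<eta>_def divide_right_mono)
qed

section \<open>The constants of the bound\<close>

lemma Lp_norm_nonneg [simp]: "0 \<le> Lp_norm M p Z"
  by (simp add: Lp_norm_def)

lemma Lp_norm_power:
  assumes "k > 0"
  shows "Lp_norm M (real k) Z ^ k = (\<integral>\<omega>. \<bar>Z \<omega>\<bar> ^ k \<partial>M)"
proof -
  have "Lp_norm M (real k) Z ^ k = Lp_norm M (real k) Z powr real k"
    using assms by (simp add: powr_realpow')
  also have "\<dots> = (\<integral>\<omega>. \<bar>Z \<omega>\<bar> powr real k \<partial>M)"
    using assms by (simp add: Lp_norm_def powr_powr)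
  finally show ?thesis using assms by (simp add: powr_realpow')
qed

lemma finite_Lp_norm_integrable:
  assumes "finite_Lp_norm M (real k) Z" "k > 0"
  shows "integrable M (\<lambda>\<omega>. \<bar>Z \<omega>\<bar> ^ k)"
  using assms by (simp add: finite_Lp_norm_def powr_realpow')

text \<open>361 is the square of 19, the leading constant of \<open>H2\<close>: a nontrivial bound
  forces \<open>n > 361\<close>, and then \<open>ln n >= 5\<close>.\<close>

lemma exp_5_le: "exp 5 \<le> (361 :: real)"
proof -
  have "exp (5 :: real) = exp 1 ^ 5" by (simp flip: exp_of_nat_mult)
  also have "\<dots> \<le> (2.72 :: real) ^ 5" using e_less_272 by (intro power_mono) auto
  also have "\<dots> \<le> 361" by (simp add: power_divide)
  finally show ?thesis .
qed

lemma std_dev_squared: "prob_space M \<Longrightarrow> (std_dev M Z)\<^sup>2 = prob_space.variance M Z"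
  by (simp add: std_dev_def prob_space.variance_positive)

lemma std_dev_nonneg: "prob_space M \<Longrightarrow> 0 \<le> std_dev M Z"
  by (simp add: std_dev_def prob_space.variance_positive)

lemma centred_moments:
  fixes X :: "'a \<Rightarrow> real"
  assumes M: "prob_space M" and X: "X \<in> borel_measurable M" and X2: "integrable M (\<lambda>\<omega>. (X \<omega>)\<^sup>2)"
  shows "centred M X \<in> borel_measurable M"
    and "(\<integral>\<omega>. centred M X \<omega> \<partial>M) = 0"
    and "integrable M (centred M X)"
    and "integrable M (\<lambda>\<omega>. (centred M X \<omega>)\<^sup>2)"
    and "(\<integral>\<omega>. (centred M X \<omega>)\<^sup>2 \<partial>M) = (std_dev M X)\<^sup>2"
proof -
  interpret prob_space M by fact
  have "integrable M X" by (rule square_integrable_imp_integrable[OF X X2])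
  then show "centred M X \<in> borel_measurable M"
    "(\<integral>\<omega>. centred M X \<omega> \<partial>M) = 0"
    "integrable M (centred M X)"
    "integrable M (\<lambda>\<omega>. (centred M X \<omega>)\<^sup>2)"
    "(\<integral>\<omega>. (centred M X \<omega>)\<^sup>2 \<partial>M) = (std_dev M X)\<^sup>2"
    using X X2 unfolding std_dev_squared[OF M]
    by (simp_all add: centred_def[abs_def] prob_space power2_diff)
qed

text \<open>The choice of the slope makes the error orthogonal to the centred \<open>X\<close>, so
  the last identity is Pythagoras; it yields both \<open>sE <= sY\<close> and
  \<open>\<bar>t\<bar> * sX <= sY\<close>.\<close>

lemma regression_error_moments:
  fixes X Y :: "'a \<Rightarrow> real"
  assumes M: "prob_space M"
    and X: "X \<in> borel_measurable M" "integrable M (\<lambda>\<omega>. (X \<omega>)\<^sup>2)"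
    and Y: "Y \<in> borel_measurable M" "integrable M (\<lambda>\<omega>. (Y \<omega>)\<^sup>2)"
    and s: "std_dev M X \<noteq> 0" "std_dev M Y \<noteq> 0"
  shows "(\<integral>\<omega>. regression_error M X Y \<omega> \<partial>M) = 0"
    and "(\<integral>\<omega>. centred M X \<omega> * regression_error M X Y \<omega> \<partial>M) = 0"
    and "integrable M (\<lambda>\<omega>. (regression_error M X Y \<omega>)\<^sup>2)"
    and "(\<integral>\<omega>. (regression_error M X Y \<omega>)\<^sup>2 \<partial>M) = (std_dev M (regression_error M X Y))\<^sup>2"
    and "(std_dev M (regression_error M X Y))\<^sup>2 + (slope M X Y * std_dev M X)\<^sup>2 = (std_dev M Y)\<^sup>2"
proof -
  interpret prob_space M by fact
  let ?X = "centred M X" and ?Y = "centred M Y" and ?E = "regression_error M X Y" and ?t = "slope M X Y"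
  note CX = centred_moments[OF M X] and CY = centred_moments[OF M Y]
  have pos: "0 < std_dev M X" "0 < std_dev M Y"
    using s std_dev_nonneg[OF M] by (auto simp: less_le)
  have XY: "integrable M (\<lambda>\<omega>. ?X \<omega> * ?Y \<omega>)"
    by (rule integral_abs_mult_le(1)[OF CX(1) CY(1) CX(4) CY(4) pos(1) CX(5) pos(2) CY(5)])
  have cov: "(\<integral>\<omega>. ?X \<omega> * ?Y \<omega> \<partial>M) = ?t * (std_dev M X)\<^sup>2"
    using pos by (simp add: slope_def covariance_def flip: std_dev_squared[OF M])
  have E: "?E = (\<lambda>\<omega>. ?Y \<omega> - ?t * ?X \<omega>)" by (simp add: fun_eq_iff regression_error_def)
  have XE: "?X \<omega> * ?E \<omega> = ?X \<omega> * ?Y \<omega> - ?t * (?X \<omega>)\<^sup>2" for \<omega>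
    by (simp add: E power2_eq_square algebra_simps)
  have EE: "(?E \<omega>)\<^sup>2 = (?Y \<omega>)\<^sup>2 - 2 * ?t * (?X \<omega> * ?Y \<omega>) + ?t\<^sup>2 * (?X \<omega>)\<^sup>2" for \<omega>
    by (simp add: E power2_eq_square algebra_simps)
  show mean: "(\<integral>\<omega>. ?E \<omega> \<partial>M) = 0" using CX CY by (simp add: E)
  show "(\<integral>\<omega>. ?X \<omega> * ?E \<omega> \<partial>M) = 0" unfolding XE using CX CY XY by (simp add: cov)
  show "integrable M (\<lambda>\<omega>. (?E \<omega>)\<^sup>2)" unfolding EE using CX CY XY by simp
  show E2: "(\<integral>\<omega>. (?E \<omega>)\<^sup>2 \<partial>M) = (std_dev M ?E)\<^sup>2"
    by (simp add: std_dev_squared[OF M] mean)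
  show "(std_dev M ?E)\<^sup>2 + (?t * std_dev M X)\<^sup>2 = (std_dev M Y)\<^sup>2"
    unfolding E2[symmetric] EE using CX CY XY
    by (simp add: cov power_mult_distrib power2_eq_square[of ?t])
qed

text \<open>An entry \<open>a / d\<close> of the minimum yields \<open>4 * d * K <= s * a\<close>,
  the 4 being that of the prefactor; thus 72 and 288 in the entries become 288 and 1152.\<close>

lemma K_const_bounds:
  assumes M: "prob_space M" and den: "all_denominators_nonzero M X Y"
  defines "s \<equiv> Lp_norm M 2 (\<lambda>\<omega>. centred M X \<omega> * regression_error M X Y \<omega>)"
    and "K \<equiv> K_const M X Y"
  shows "0 < K"
    and "4 * (Lp_norm M 4 (\<lambda>\<omega>. centred M X \<omega> * regression_error M X Y \<omega>))\<^sup>2 * K \<le> s\<^sup>2"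
    and "288 * K * Lp_norm M 3 (centred M X) ^ 3 * (std_dev M Y)\<^sup>2 \<le> s\<^sup>2 * std_dev M X"
    and "1152 * K * Lp_norm M 4 (centred M X) ^ 4 * std_dev M Y \<le> s * std_dev M X ^ 3"
proof -
  have lp: "Lp_norm M p Z \<noteq> 0 \<longleftrightarrow> 0 < Lp_norm M p Z" for p Z
    by (auto simp: less_le)
  have sd: "std_dev M Z \<noteq> 0 \<longleftrightarrow> 0 < std_dev M Z" for Z
    using std_dev_nonneg[OF M, of Z] by auto
  note nz = den[unfolded all_denominators_nonzero_def lp sd]
  have s: "0 < s" unfolding s_def using nz by simp
  \<comment> \<open>Hiding the set behind \<open>A\<close> settles the case distinction on a
    vanishing slope once.\<close>
  obtain A where A: "finite A" "K = s / 4 * Min A" "\<forall>a\<in>A. 0 < a"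
    "s / (Lp_norm M 4 (\<lambda>\<omega>. centred M X \<omega> * regression_error M X Y \<omega>))\<^sup>2 \<in> A"
    "s * std_dev M X / (72 * Lp_norm M 3 (centred M X) ^ 3 * (std_dev M Y)\<^sup>2) \<in> A"
    "std_dev M X ^ 3 / (288 * Lp_norm M 4 (centred M X) ^ 4 * std_dev M Y) \<in> A"
    by (rule that[OF _ K_const_def[of M X Y, folded s_def K_def]])
      (use nz s in \<open>simp_all\<close>)
  have "0 < Min A" using A by (subst Min_gr_iff) auto
  then show "0 < K" unfolding A(2) using s by simp
  have K: "4 * d * K \<le> s * a" if "a / d \<in> A" "0 < d" for a d
  proof -
    have "K \<le> s / 4 * (a / d)" unfolding A(2) using that A(1) s by (intro mult_left_mono) auto
    then show ?thesis using that(2) by (simp add: field_simps)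
  qed
  show "4 * (Lp_norm M 4 (\<lambda>\<omega>. centred M X \<omega> * regression_error M X Y \<omega>))\<^sup>2 * K \<le> s\<^sup>2"
    using K[OF A(4)] nz by (simp add: power2_eq_square)
  show "288 * K * Lp_norm M 3 (centred M X) ^ 3 * (std_dev M Y)\<^sup>2 \<le> s\<^sup>2 * std_dev M X"
    using K[OF A(5)] nz by (simp add: power2_eq_square mult_ac)
  show "1152 * K * Lp_norm M 4 (centred M X) ^ 4 * std_dev M Y \<le> s * std_dev M X ^ 3"
    using K[OF A(6)] nz by (simp add: mult_ac)
qed

text \<open>These summands absorb the Berry--Esseen error and the exceptional probabilities; the
  other summands are nonnegative. The auxiliary \<open>split\<close> keeps the arithmetic linear by
  naming every summand.\<close>

lemma H2_lower_bound:
  fixes X Y :: "'a \<Rightarrow> real"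
  assumes M: "prob_space M" and c: "0 \<le> c"
  defines "Z \<equiv> \<lambda>\<omega>. centred M X \<omega> * regression_error M X Y \<omega>"
  shows "19 + 9 * (c * (Lp_norm M 3 Z ^ 3 / Lp_norm M 2 Z ^ 3))
    + 6 * (c * (Lp_norm M 3 (regression_error M X Y) ^ 3 / std_dev M (regression_error M X Y) ^ 3))
    + 16 * (c * (Lp_norm M 3 (centred M X) ^ 3 / std_dev M X ^ 3))
    + 2 * (c * (Lp_norm M 6 Z ^ 6 / prob_space.variance M (\<lambda>\<omega>. (centred M X \<omega>)\<^sup>2 * (regression_error M X Y \<omega>)\<^sup>2) powr (3/2)))
    + 12 * ((Lp_norm M 4 (centred M Y))\<^sup>2 / (std_dev M Y)\<^sup>2)
    + 32 * ((Lp_norm M 4 (centred M X))\<^sup>2 / (std_dev M X)\<^sup>2)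
    + 16 * (Lp_norm M 6 (centred M X) ^ 6 / Lp_norm M 4 (centred M X) ^ 6) \<le> H2 M X Y c"
proof -
  have split: "19 + 9 * p1 + 6 * p2 + 16 * p3 + 2 * p4 + 12 * p5 + 32 * p6 + 16 * p7
      \<le> 19 + z1 + p1' + p2' + p3' + p4' + z2 + z3 + z4 + z5 + z6 + p5' + p6' + z7 + z8 + p7' + z9
        + z10 + z11 + z12 + z13 + z14 + z15 + z16 + z17 + z18"
    if "9 * p1 = p1'" "6 * p2 = p2'" "16 * p3 = p3'" "2 * p4 = p4'" "12 * p5 = p5'" "32 * p6 = p6'" "16 * p7 = p7'"
      "0 \<le> z1" "0 \<le> z2" "0 \<le> z3" "0 \<le> z4" "0 \<le> z5" "0 \<le> z6" "0 \<le> z7" "0 \<le> z8" "0 \<le> z9" "0 \<le> z10"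
      "0 \<le> z11" "0 \<le> z12" "0 \<le> z13" "0 \<le> z14" "0 \<le> z15" "0 \<le> z16" "0 \<le> z17" "0 \<le> z18"
    for p1 p2 p3 p4 p5 p6 p7 p1' p2' p3' p4' p5' p6' p7' z1 z2 z3 z4 z5 z6 z7 z8 z9 z10
      z11 z12 z13 z14 z15 z16 z17 z18 :: real
    using that by linarith
  show ?thesis
    unfolding H2_def Z_def
    by (rule split) (simp_all add: c std_dev_nonneg[OF M])
qed

theorem proposition2p1:
  fixes M :: "'a measure" and X Y :: "'a \<Rightarrow> real"
    and Xs Ys :: "nat \<Rightarrow> 'a \<Rightarrow> real" and n :: nat
    and c\<^sub>B\<^sub>E c\<^sub>1\<^sub>R c\<^sub>2\<^sub>R d d' d'' :: real
  assumes "prob_space M"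
    and "berry_esseen_constant c\<^sub>B\<^sub>E"
    and "rosenthal_constants c\<^sub>1\<^sub>R c\<^sub>2\<^sub>R"
    and "n \<ge> 2"
    and "X \<in> borel_measurable M" and "Y \<in> borel_measurable M"
    and "integrable M (\<lambda>\<omega>. (X \<omega>)\<^sup>2)" and "integrable M (\<lambda>\<omega>. (Y \<omega>)\<^sup>2)"
    and "prob_space.variance M X > 0"
    and "independent_copies M n (\<lambda>i \<omega>. (Xs i \<omega>, Ys i \<omega>)) (\<lambda>\<omega>. (X \<omega>, Y \<omega>))"
    and "all_norms_finite M X Y"
    and "all_denominators_nonzero M X Y"
  shows "(SUP x::real. \<bar>measure M {\<omega> \<in> space M.
            studentised_slope d d' d'' (slope M X Y) n (\<lambda>i. Xs i \<omega>) (\<lambda>i. Ys i \<omega>) \<le> x} - \<Phi> x\<bar>)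
       \<le> ln (real n) / sqrt (real n) * H1 M X Y
         + H2 M X Y c\<^sub>B\<^sub>E / sqrt (real n)
         + H3 M X Y / sqrt (real n * ln (real n))
         + H4 M X Y c\<^sub>1\<^sub>R / real n
         + H5 M X Y c\<^sub>2\<^sub>R / real n powr (3/2)"
proof -
  note M = assms(1) and BE = assms(2) and n = assms(4) and X = assms(5,7) and Y = assms(6,8)
    and P = assms(10) and fin = assms(11)[unfolded all_norms_finite_def] and den = assms(12)
  note nz = den[unfolded all_denominators_nonzero_def]
  interpret prob_space M by fact
  let ?T = "\<lambda>\<omega>. studentised_slope d d' d'' (slope M X Y) n (\<lambda>i. Xs i \<omega>) (\<lambda>i. Ys i \<omega>)"
  let ?X = "centred M X" and ?Y = "centred M Y" and ?E = "regression_error M X Y" and ?t = "slope M X Y"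
  let ?XE = "\<lambda>\<omega>. ?X \<omega> * ?E \<omega>"
  define RHS where "RHS = ln (real n) / sqrt (real n) * H1 M X Y + H2 M X Y c\<^sub>B\<^sub>E / sqrt (real n)
    + H3 M X Y / sqrt (real n * ln (real n)) + H4 M X Y c\<^sub>1\<^sub>R / real n + H5 M X Y c\<^sub>2\<^sub>R / real n powr (3/2)"
  define K where "K = K_const M X Y"
  define s where "s = Lp_norm M 2 ?XE"
  define q where "q = (Lp_norm M 4 ?XE)\<^sup>2"
  define r where "r = Lp_norm M 4 ?X"
  define v where "v = sqrt (variance (\<lambda>\<omega>. (?XE \<omega>)\<^sup>2))"
  define sX where "sX = std_dev M X"
  define sY where "sY = std_dev M Y"
  define sE where "sE = std_dev M ?E"
  define g where "g = ln (real n) / sqrt (real n)"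
  have n0: "0 < real n" "0 < ln (real n)" using n by auto
  have c: "0 < c\<^sub>B\<^sub>E" using BE by (simp add: berry_esseen_constant_def)
  have g0: "0 \<le> g" using n0 by (simp add: g_def)
  have varXE: "variance (\<lambda>\<omega>. (?XE \<omega>)\<^sup>2) = variance (\<lambda>\<omega>. (?X \<omega>)\<^sup>2 * (?E \<omega>)\<^sup>2)"
    by (simp add: power_mult_distrib)
  have pos: "0 < sX" "0 < sY" "0 < sE" "0 < s" "0 < v" "0 < q" "0 < r"
    using nz std_dev_nonneg[OF M] unfolding sX_def sY_def sE_def s_def v_def q_def r_def varXE
    by (auto simp: less_le variance_positive)
  note Kb = K_const_bounds[OF M den, folded K_def s_def sX_def sY_def q_def r_def]
  have K: "0 < K" by (rule Kb(1))

  note H2 = H2_lower_bound[OF M less_imp_le[OF c], of X Y, folded s_def sX_def sY_def sE_def r_def]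
  have H2_19: "19 \<le> H2 M X Y c\<^sub>B\<^sub>E"
    using c pos variance_positive by (intro order_trans[OF _ H2]) (simp add: add_nonneg_nonneg)
  have H1: "g * H1 M X Y = 3 * (g * (sX * sE) / s) / sqrt (2 * pi) + g / K / sqrt (2 * pi)"
    using pos K unfolding H1_def sX_def sE_def s_def K_def by (simp add: field_simps)
  have "0 \<le> H3 M X Y"
    unfolding H3_def K_def[symmetric] using K std_dev_nonneg[OF M] by simp
  moreover have "0 \<le> H4 M X Y c\<^sub>1\<^sub>R" "0 \<le> H5 M X Y c\<^sub>2\<^sub>R"
    unfolding H4_def H5_def using std_dev_nonneg[OF M] by simp_all
  ultimately have RHS: "g * H1 M X Y + H2 M X Y c\<^sub>B\<^sub>E / sqrt (real n) \<le> RHS"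
    using n0 by (simp add: RHS_def g_def)
  have g_K: "g / K / sqrt (2 * pi) \<le> g * H1 M X Y"
    unfolding H1 using pos g0 by simp

  have bound: "\<bar>prob {\<omega> \<in> space M. ?T \<omega> \<le> x} - \<Phi> x\<bar> \<le> RHS" for x
  proof (cases "1 \<le> RHS")
    case True
    have "\<bar>prob {\<omega> \<in> space M. ?T \<omega> \<le> x} - \<Phi> x\<bar> \<le> 1"
      using prob_le_1[of "{\<omega> \<in> space M. ?T \<omega> \<le> x}"] measure_nonneg[of M "{\<omega> \<in> space M. ?T \<omega> \<le> x}"]
        std_normal_cdf_nonneg[of x] std_normal_cdf_le_1[of x] by linarith
    then show ?thesis using True by linarith
  next
    case False
    define u where "u = sqrt (ln (real n) / real n)"
    have u_g: "sqrt (real n) * u\<^sup>2 = g"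
      using n0 by (simp add: u_def g_def real_div_sqrt field_simps)
    \<comment> \<open>Since \<open>RHS < 1\<close>, each of its nonnegative parts is below 1: the
      constant 19 of \<open>H2\<close> makes \<open>n\<close> large, and the second summand of
      \<open>H1\<close> bounds \<open>g / K\<close>.\<close>
    have "19 / sqrt (real n) \<le> H2 M X Y c\<^sub>B\<^sub>E / sqrt (real n)"
      using H2_19 by (rule divide_right_mono) simp
    moreover have "0 \<le> g / K / sqrt (2 * pi)" "0 \<le> H2 M X Y c\<^sub>B\<^sub>E / sqrt (real n)"
      using g0 K H2_19 by simp_all
    ultimately have "19 / sqrt (real n) < 1" and gK1: "g / K / sqrt (2 * pi) < 1"
      using False RHS g_K by linarith+
    then have "19 < sqrt (real n)" using n0 by simp
    then have "19\<^sup>2 < (sqrt (real n))\<^sup>2" by (intro power_strict_mono) auto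
    then have "exp 5 \<le> real n" using exp_5_le by simp
    then have ln5: "5 \<le> ln (real n)" using n0 by (simp add: ln_ge_iff)
    have ug: "u \<le> g"
    proof -
      have "sqrt (ln (real n)) \<le> ln (real n)" using ln5 by (intro real_le_lsqrt) (auto simp: power2_eq_square)
      then show ?thesis by (simp add: u_def g_def real_sqrt_divide divide_right_mono)
    qed
    \<comment> \<open>From \<open>5 * u^2 <= g^2 < 2 * pi * K^2\<close> and
      \<open>2 * pi <= 6.3\<close>; the ratio \<open>9 / 8\<close> fits because
      \<open>64 * 6.3 / 5 = 80.64 <= 81\<close>.\<close>
    have uK: "8 * u \<le> 9 * K"
    proof (rule power2_le_imp_le)
      have "g < K * sqrt (2 * pi)" using gK1 K by (simp add: field_simps)
      then have "g\<^sup>2 \<le> (K * sqrt (2 * pi))\<^sup>2" using g0 by (intro power_mono) auto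
      also have "\<dots> = K\<^sup>2 * (2 * pi)" by (simp add: power_mult_distrib)
      also have "\<dots> \<le> K\<^sup>2 * 6.3" using pi_approx(2) by (intro mult_left_mono) auto
      finally have "g\<^sup>2 \<le> K\<^sup>2 * 6.3" .
      moreover have "5 * u\<^sup>2 \<le> ln (real n) * u\<^sup>2" using ln5 by (rule mult_right_mono) simp
      moreover have "ln (real n) * u\<^sup>2 = g\<^sup>2"
        using n0 by (simp add: u_def g_def power_divide power2_eq_square)
      ultimately have "64 * u\<^sup>2 \<le> 81 * K\<^sup>2" using zero_le_power2[of K] by linarith
      then show "(8 * u)\<^sup>2 \<le> (9 * K)\<^sup>2" by (simp add: power_mult_distrib)
    qed (use K in simp)

    note CX = centred_moments[OF M X] and CY = centred_moments[OF M Y]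
    have sd: "std_dev M X \<noteq> 0" "std_dev M Y \<noteq> 0" using nz by auto
    note RE = regression_error_moments[OF M X Y sd, folded sX_def sY_def sE_def]
    have E: "?E = (\<lambda>\<omega>. ?Y \<omega> - ?t * ?X \<omega>)" by (simp add: fun_eq_iff regression_error_def)
    have Em: "?E \<in> borel_measurable M" unfolding E using CX CY by simp
    have sE_sY: "sE \<le> sY" and t_sX: "\<bar>?t\<bar> * sX \<le> sY"
    proof -
      have "sE\<^sup>2 \<le> sY\<^sup>2" using RE(5) zero_le_power2[of "?t * sX"] by linarith
      then show "sE \<le> sY" by (rule power2_le_imp_le) (use pos in simp)
      have "(?t * sX)\<^sup>2 \<le> sY\<^sup>2" using RE(5) zero_le_power2[of sE] by linarith
      then have "(\<bar>?t\<bar> * sX)\<^sup>2 \<le> sY\<^sup>2" by (simp add: power_mult_distrib)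
      then show "\<bar>?t\<bar> * sX \<le> sY" by (rule power2_le_imp_le) (use pos in simp)
    qed
    have int: "integrable M (\<lambda>\<omega>. \<bar>?X \<omega>\<bar> ^ 3)" "integrable M (\<lambda>\<omega>. \<bar>?X \<omega>\<bar> ^ 4)" "integrable M (\<lambda>\<omega>. \<bar>?X \<omega>\<bar> ^ 6)"
      "integrable M (\<lambda>\<omega>. \<bar>?Y \<omega>\<bar> ^ 4)" "integrable M (\<lambda>\<omega>. \<bar>?E \<omega>\<bar> ^ 3)"
      "integrable M (\<lambda>\<omega>. \<bar>?XE \<omega>\<bar> ^ 2)" "integrable M (\<lambda>\<omega>. \<bar>?XE \<omega>\<bar> ^ 3)"
      "integrable M (\<lambda>\<omega>. \<bar>?XE \<omega>\<bar> ^ 4)" "integrable M (\<lambda>\<omega>. \<bar>?XE \<omega>\<bar> ^ 6)"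
      by (rule finite_Lp_norm_integrable; use fin in simp)+
    have int': "integrable M (\<lambda>\<omega>. ?X \<omega> ^ 4)" "integrable M (\<lambda>\<omega>. ?X \<omega> ^ 6)" "integrable M (\<lambda>\<omega>. ?Y \<omega> ^ 4)"
      "integrable M (\<lambda>\<omega>. ?XE \<omega> ^ 4)" "integrable M (\<lambda>\<omega>. ?XE \<omega> ^ 6)"
      using int(2,3,4,8,9) by simp_all
    have v2: "variance (\<lambda>\<omega>. (?XE \<omega>)\<^sup>2) = v\<^sup>2" by (simp add: v_def variance_positive)
    have pow: "(\<integral>\<omega>. \<bar>Z \<omega>\<bar> ^ 2 \<partial>M) = (Lp_norm M 2 Z)\<^sup>2" "(\<integral>\<omega>. \<bar>Z \<omega>\<bar> ^ 3 \<partial>M) = Lp_norm M 3 Z ^ 3"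
      "(\<integral>\<omega>. \<bar>Z \<omega>\<bar> ^ 4 \<partial>M) = Lp_norm M 4 Z ^ 4" "(\<integral>\<omega>. \<bar>Z \<omega>\<bar> ^ 6 \<partial>M) = Lp_norm M 6 Z ^ 6" for Z
      using Lp_norm_power[of 2 M Z] Lp_norm_power[of 3 M Z] Lp_norm_power[of 4 M Z] Lp_norm_power[of 6 M Z]
      by simp_all
    have XE2: "(\<integral>\<omega>. (?XE \<omega>)\<^sup>2 \<partial>M) = s\<^sup>2" using pow(1)[of ?XE] by (simp add: s_def)
    have XE4: "(\<integral>\<omega>. ?XE \<omega> ^ 4 \<partial>M) = q\<^sup>2" using pow(3)[of ?XE] by (simp add: q_def flip: power_mult)
    have X4: "(\<integral>\<omega>. ?X \<omega> ^ 4 \<partial>M) = r ^ 4" using pow(3)[of ?X] by (simp add: r_def)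
    have XEi: "integrable M (\<lambda>\<omega>. \<bar>?XE \<omega>\<bar>)" "(\<integral>\<omega>. \<bar>?XE \<omega>\<bar> \<partial>M) \<le> sX * sE"
      using integral_abs_mult_le[OF CX(1) Em CX(4) RE(3) pos(1) _ pos(3) RE(4)] CX(5) by (simp_all add: sX_def)
    have q1: "s\<^sup>2 \<le> q"
    proof (rule power2_le_imp_le)
      show "(s\<^sup>2)\<^sup>2 \<le> q\<^sup>2"
        using second_moment_squared_le[OF M, of ?XE] int unfolding XE2 XE4 by simp
    qed (use pos in simp)
    have q2: "s ^ 3 \<le> sX * sY * q"
    proof -
      have "s ^ 3 \<le> q * (\<integral>\<omega>. \<bar>?XE \<omega>\<bar> \<partial>M)"
        using int XEi XE2 XE4 pos by (intro second_moment_interpolation) auto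
      also have "\<dots> \<le> q * (sX * sY)"
        using XEi(2) sE_sY pos by (intro mult_left_mono order_trans[OF XEi(2)]) auto
      finally show ?thesis by (simp add: mult_ac)
    qed
    \<comment> \<open>Lyapunov's inequality replaces the cubed third norm in the bound for
      \<open>K\<close> by \<open>sX ^ 3\<close>, after which one factor \<open>sX\<close>
      cancels.\<close>
    have k2: "288 * K * (sX * sY)\<^sup>2 \<le> s\<^sup>2"
    proof -
      have "sX ^ 3 \<le> (\<integral>\<omega>. \<bar>?X \<omega>\<bar> ^ 3 \<partial>M)"
        using CX(4,5) int(1) pos(1) by (intro sqrt_second_moment_cubed_le[OF M]) (auto simp: sX_def)
      then have "288 * K * sX ^ 3 * sY\<^sup>2 \<le> 288 * K * Lp_norm M 3 ?X ^ 3 * sY\<^sup>2"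
        using K unfolding pow by (intro mult_right_mono mult_left_mono) auto
      also note Kb(3)
      finally have "sX * (288 * K * (sX * sY)\<^sup>2) \<le> sX * s\<^sup>2"
        by (simp add: power2_eq_square power3_eq_cube mult_ac)
      then show ?thesis using pos(1) by (simp only: mult_le_cancel_left_pos)
    qed
    have cP: "independent_copies M n (\<lambda>i \<omega>. (Xs i \<omega> - integral\<^sup>L M X, Ys i \<omega> - integral\<^sup>L M Y)) (\<lambda>\<omega>. (?X \<omega>, ?Y \<omega>))"
    proof -
      have "(\<lambda>p. (fst p - integral\<^sup>L M X, snd p - integral\<^sup>L M Y)) \<in> borel_measurable borel"
        by (intro borel_measurable_continuous_onI continuous_intros)
      moreover have "(\<lambda>\<omega>. (X \<omega>, Y \<omega>)) \<in> borel_measurable M" using X Y by simp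
      ultimately show ?thesis
        using independent_copies_compose[OF M P] unfolding centred_def by fastforce
    qed
    have T: "?T \<omega> = studentised_slope d d' d'' ?t n (\<lambda>i. Xs i \<omega> - integral\<^sup>L M X) (\<lambda>i. Ys i \<omega> - integral\<^sup>L M Y)" for \<omega>
      using n by (simp add: studentised_slope_shift)
    have "\<bar>prob {\<omega> \<in> space M. ?T \<omega> \<le> x} - \<Phi> x\<bar>
      \<le> (sqrt (real n) * u\<^sup>2 * (sX * sE) / s + u / K) / sqrt (2 * pi)
        + (8 + 3 * c\<^sub>B\<^sub>E * ((\<integral>\<omega>. \<bar>?XE \<omega>\<bar> ^ 3 \<partial>M) / s ^ 3) + 2 * c\<^sub>B\<^sub>E * ((\<integral>\<omega>. \<bar>?E \<omega>\<bar> ^ 3 \<partial>M) / sE ^ 3)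
        + 2 * c\<^sub>B\<^sub>E * ((\<integral>\<omega>. \<bar>?X \<omega>\<bar> ^ 3 \<partial>M) / sX ^ 3) + 2 * c\<^sub>B\<^sub>E * ((\<integral>\<omega>. ?XE \<omega> ^ 6 \<partial>M) / v ^ 3)
        + 4 * (r\<^sup>2 / sX\<^sup>2) + 4 * (sqrt (\<integral>\<omega>. ?Y \<omega> ^ 4 \<partial>M) / sY\<^sup>2)
        + 2 * ((\<integral>\<omega>. ?X \<omega> ^ 6 \<partial>M) / r ^ 6)) / sqrt (real n)"
      unfolding T
      by (rule studentised_slope_normal_approx[OF M BE _ CX(1) CY(1) cP E CX(2) RE(1,2) pos K
            CX(5)[folded sX_def] CY(5)[folded sY_def] RE(4) XE2 int'(4) XE4 v2 int'(1) X4 int'(3) int'(2) int'(5)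
            int(1,5,7) sE_sY t_sX Kb(2) k2 Kb(4) q1 q2 u_def uK])
        (use n in simp)
    also have "\<dots> \<le> g * H1 M X Y + H2 M X Y c\<^sub>B\<^sub>E / sqrt (real n)"
    proof (rule add_mono[OF _ divide_right_mono[OF order_trans[OF _ H2]]])
      define z where "z = g * (sX * sE) / s"
      have "u / K \<le> g / K" using ug K by (intro divide_right_mono) auto
      moreover have "0 \<le> z" using g0 pos by (simp add: z_def)
      ultimately have "(z + u / K) / sqrt (2 * pi) \<le> (3 * z + g / K) / sqrt (2 * pi)"
        by (intro divide_right_mono) simp_all
      then show "(sqrt (real n) * u\<^sup>2 * (sX * sE) / s + u / K) / sqrt (2 * pi) \<le> g * H1 M X Y"
        unfolding H1 u_g z_def by (simp add: add_divide_distrib)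
      have v3: "v ^ 3 = variance (\<lambda>\<omega>. (?X \<omega>)\<^sup>2 * (?E \<omega>)\<^sup>2) powr (3/2)"
      proof -
        have "v ^ 3 = v powr 3" using pos by (simp add: powr_numeral)
        then show ?thesis
          by (simp add: v_def varXE[symmetric] powr_powr flip: powr_half_sqrt)
      qed
      have Y4: "sqrt (\<integral>\<omega>. ?Y \<omega> ^ 4 \<partial>M) = (Lp_norm M 4 ?Y)\<^sup>2"
        using pow(3)[of ?Y] by (intro real_sqrt_unique) (simp_all flip: power_mult)
      have i6: "(\<integral>\<omega>. ?XE \<omega> ^ 6 \<partial>M) = Lp_norm M 6 ?XE ^ 6" "(\<integral>\<omega>. ?X \<omega> ^ 6 \<partial>M) = Lp_norm M 6 ?X ^ 6"
        using pow(4)[of ?XE] pow(4)[of ?X] by simp_all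
      show "8 + 3 * c\<^sub>B\<^sub>E * ((\<integral>\<omega>. \<bar>?XE \<omega>\<bar> ^ 3 \<partial>M) / s ^ 3) + 2 * c\<^sub>B\<^sub>E * ((\<integral>\<omega>. \<bar>?E \<omega>\<bar> ^ 3 \<partial>M) / sE ^ 3)
        + 2 * c\<^sub>B\<^sub>E * ((\<integral>\<omega>. \<bar>?X \<omega>\<bar> ^ 3 \<partial>M) / sX ^ 3) + 2 * c\<^sub>B\<^sub>E * ((\<integral>\<omega>. ?XE \<omega> ^ 6 \<partial>M) / v ^ 3)
        + 4 * (r\<^sup>2 / sX\<^sup>2) + 4 * (sqrt (\<integral>\<omega>. ?Y \<omega> ^ 4 \<partial>M) / sY\<^sup>2)
        + 2 * ((\<integral>\<omega>. ?X \<omega> ^ 6 \<partial>M) / r ^ 6)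
        \<le> 19 + 9 * (c\<^sub>B\<^sub>E * (Lp_norm M 3 ?XE ^ 3 / s ^ 3)) + 6 * (c\<^sub>B\<^sub>E * (Lp_norm M 3 ?E ^ 3 / sE ^ 3))
        + 16 * (c\<^sub>B\<^sub>E * (Lp_norm M 3 ?X ^ 3 / sX ^ 3))
        + 2 * (c\<^sub>B\<^sub>E * (Lp_norm M 6 ?XE ^ 6 / variance (\<lambda>\<omega>. (?X \<omega>)\<^sup>2 * (?E \<omega>)\<^sup>2) powr (3/2)))
        + 12 * ((Lp_norm M 4 ?Y)\<^sup>2 / sY\<^sup>2) + 32 * (r\<^sup>2 / sX\<^sup>2) + 16 * (Lp_norm M 6 ?X ^ 6 / r ^ 6)"
      proof -
        \<comment> \<open>\<open>a4\<close> carries no sign condition because its coefficient is the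
          same on both sides.\<close>
        have arith: "8 + 3 * c\<^sub>B\<^sub>E * a1 + 2 * c\<^sub>B\<^sub>E * a2 + 2 * c\<^sub>B\<^sub>E * a3 + 2 * c\<^sub>B\<^sub>E * a4 + 4 * a6 + 4 * a5 + 2 * a7
          \<le> 19 + 9 * (c\<^sub>B\<^sub>E * a1) + 6 * (c\<^sub>B\<^sub>E * a2) + 16 * (c\<^sub>B\<^sub>E * a3) + 2 * (c\<^sub>B\<^sub>E * a4) + 12 * a5 + 32 * a6 + 16 * a7"
          if "0 \<le> a1" "0 \<le> a2" "0 \<le> a3" "0 \<le> a5" "0 \<le> a6" "0 \<le> a7" for a1 a2 a3 a4 a5 a6 a7
        proof -
          have "0 \<le> c\<^sub>B\<^sub>E * a1" "0 \<le> c\<^sub>B\<^sub>E * a2" "0 \<le> c\<^sub>B\<^sub>E * a3" using that c by simp_all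
          then show ?thesis using that unfolding mult.assoc by linarith
        qed
        show ?thesis
          unfolding pow v3 Y4 i6 using pos by (intro arith) auto
      qed
    qed simp_all
    also note RHS
    finally show ?thesis .
  qed
  show ?thesis
    unfolding RHS_def[symmetric] by (rule cSUP_least) (auto intro: bound)
qed

end
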